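(* For a uniformly random permutation $\pi_n\in S_n$, as $n\to\infty$, $$\frac{\delta(G_{\pi_n})}{\sqrt n}\to\Gamma\quad\text{in distribution},$$ where $\delta(G_{\pi_n})$ is the minimum degree of the permutation graph $G_{\pi_n}$ and $\Gamma$ has the Rayleigh distribution with parameter $\frac{1}{\sqrt2}$, that is, $\mathbb{P}(\Gamma>\gamma)=e^{-\gamma^2}$ for all $\gamma>0$.
   Context: $S_n$ is the set of permutations of $[n]=\{1,\dots,n\}$. The permutation graph $G_{\pi_n}$ of $\pi_n\in S_n$ has vertex set $[n]$ and an edge between $i$ and $j$ iff $(i-j)(\pi_n(i)-\pi_n(j))<0$. *)

theory Defs
  imports "HOL-Probability.Probability" "HOL-Combinatorics.Permutations" "Graph_Theory.Graph_Theory"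
begin

(* An undirected edge ij is represented, as usual in Graph_Theory, by the two arcs (i,j) and (j,i).
   The products are taken in int because subtraction on nat truncates. *)
definition permutation_graph :: "nat \<Rightarrow> (nat \<Rightarrow> nat) \<Rightarrow> nat pair_pre_digraph" where
  "permutation_graph n \<pi> =
     \<lparr> pverts = {1..n},
       parcs = {(i, j). i \<in> {1..n} \<and> j \<in> {1..n} \<and>
                        (int i - int j) * (int (\<pi> i) - int (\<pi> j)) < 0} \<rparr>"

lemma pair_graph_permutation_graph: "pair_graph (permutation_graph n \<pi>)"
proof -
  have "finite (parcs (permutation_graph n \<pi>))"
    by (rule finite_subset[of _ "{1..n} \<times> {1..n}"]) (auto simp: permutation_graph_def)
  moreover have "sym (parcs (permutation_graph n \<pi>))"
    by (auto simp: permutation_graph_def sym_def algebra_simps)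
  ultimately show ?thesis
    by unfold_locales (auto simp: permutation_graph_def symmetric_def arcs_ends_def arc_to_ends_def)
qed

(* In a graph, i.e. a symmetric loopfree digraph without multiple arcs, the out-degree of a vertex
   is its number of neighbours. Only meaningful for a finite non-empty vertex set. *)
definition min_degree :: "('a, 'b) pre_digraph \<Rightarrow> nat" where
  "min_degree G = Min (out_degree G ` verts G)"

definition rayleigh_density :: "real \<Rightarrow> real \<Rightarrow> real" where
  "rayleigh_density \<sigma> x = (if x < 0 then 0 else x / \<sigma>\<^sup>2 * exp (- x\<^sup>2 / (2 * \<sigma>\<^sup>2)))"

definition rayleigh_distribution :: "real \<Rightarrow> real measure" where
  "rayleigh_distribution \<sigma> = density lborel (\<lambda>x. ennreal (rayleigh_density \<sigma> x))"

definition uniform_permutation :: "nat \<Rightarrow> (nat \<Rightarrow> nat) pmf" where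
  "uniform_permutation n = pmf_of_set {\<pi>. \<pi> permutes {1..n}}"

end

theory Submission
  imports Defs "HOL-Real_Asymp.Real_Asymp"
begin

text \<open>
  Represent \<open>\<pi>\<close> by its points \<open>(i, \<pi> i)\<close> in the board \<open>{1..n} \<times> {1..n}\<close>. If \<open>C\<close>
  denotes the number of points below and to the left of \<open>(i, \<pi> i)\<close>, then the degree of \<open>i\<close> in
  the permutation graph is \<open>(i - 1) + (\<pi> i - 1) - 2 C\<close>; there is a mirrored formula with the
  distances to \<open>n\<close> and the number of points above and to the right (\<open>perm_degree_lower_box\<close>,
  \<open>perm_degree_upper_box\<close>). A box with sides of order \<open>sqrt n\<close> contains only boundedly many
  points on average, so within distance of order \<open>sqrt n\<close> of the corners \<open>(1, 1)\<close> and
  \<open>(n, n)\<close> the degree is essentially the distance to the corner. Everywhere else the degrees are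
  larger. Hence the minimum degree exceeds \<open>\<gamma> sqrt n\<close> essentially if and only if no point
  lies in one of two triangles of area \<open>\<gamma>\<^sup>2 n / 2\<close> at these corners. The number of points in
  the triangles has mean about \<open>\<gamma>\<^sup>2\<close> and is asymptotically Poisson, so the triangles are empty
  with limiting probability \<open>exp (- \<gamma>\<^sup>2)\<close>, the tail of the Rayleigh distribution.

  Two probabilistic facts make this precise. The first is a Poisson limit for avoiding a set of
  cells that meets every row and column in \<open>o(n)\<close> cells (\<open>prob_perm_avoid_limit\<close>). It comes
  from the exact inclusion--exclusion formula in terms of rook numbers, by passing to the limit term
  by term. The second is a second-moment bound for the number of points in a box, jointly with one
  prescribed point (\<open>chebyshev_box_count\<close>). It implies that, for \<open>\<gamma> < \<gamma>'\<close>, with probability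
  tending to one no point outside the corner regions for \<open>\<gamma>'\<close> has degree at most
  \<open>\<gamma> sqrt n\<close> (\<open>prob_low_degree_off_corner\<close>). The limit for the tail of the minimum degree
  then follows by letting \<open>\<gamma>'\<close> tend to \<open>\<gamma>\<close> (\<open>prob_min_degree_limit\<close>).
\<close>

section \<open>Uniform random permutations\<close>

lemma card_permutations_extending:
  assumes "K \<subseteq> {1..n}" "inj_on f K" "f ` K \<subseteq> {1..n}"
  shows "card {\<pi>. \<pi> permutes {1..n} \<and> (\<forall>k\<in>K. \<pi> k = f k)} = fact (n - card K)"
proof -
  have finK: "finite K"
    using assms(1) finite_subset by blast
  have "card ({1..n} - K) = card ({1..n} - f ` K)"
    using assms finK by (simp add: card_Diff_subset card_image)
  then obtain g where g: "bij_betw g ({1..n} - K) ({1..n} - f ` K)"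
    by (meson finite_same_card_bij finite_Diff finite_atLeastAtMost)
  define \<sigma> where "\<sigma> = (\<lambda>x. if x \<in> K then f x else if x \<in> {1..n} then g x else x)"
  have "bij_betw \<sigma> K (f ` K)"
    using assms(2) by (auto simp: \<sigma>_def bij_betw_def inj_on_def)
  moreover have "bij_betw \<sigma> ({1..n} - K) ({1..n} - f ` K)"
    using g by (subst bij_betw_cong[where g = g]) (auto simp: \<sigma>_def)
  ultimately have "bij_betw \<sigma> (K \<union> ({1..n} - K)) (f ` K \<union> ({1..n} - f ` K))"
    by (rule bij_betw_combine) auto
  then have "bij_betw \<sigma> {1..n} {1..n}"
    using assms by (simp add: Un_absorb1)
  then have \<sigma>: "\<sigma> permutes {1..n}"
    by (rule bij_imp_permutes) (use assms in \<open>auto simp: \<sigma>_def\<close>)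
  \<comment> \<open>Composition with one fixed extension \<open>\<sigma>\<close> of \<open>f\<close> identifies all
    extensions with the permutations of the complement of \<open>K\<close>.\<close>
  have "bij_betw (\<lambda>\<rho>. \<sigma> \<circ> \<rho>) {\<rho>. \<rho> permutes ({1..n} - K)}
          {\<pi>. \<pi> permutes {1..n} \<and> (\<forall>k\<in>K. \<pi> k = f k)}"
  proof (rule bij_betw_byWitness[where f' = "\<lambda>\<pi>. inv \<sigma> \<circ> \<pi>"])
    show "\<forall>\<rho>\<in>{\<rho>. \<rho> permutes ({1..n} - K)}. inv \<sigma> \<circ> (\<sigma> \<circ> \<rho>) = \<rho>"
      using permutes_inv_o(2)[OF \<sigma>] by (simp flip: o_assoc add: o_assoc)
    show "\<forall>\<pi>\<in>{\<pi>. \<pi> permutes {1..n} \<and> (\<forall>k\<in>K. \<pi> k = f k)}. \<sigma> \<circ> (inv \<sigma> \<circ> \<pi>) = \<pi>"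
      using permutes_inv_o(1)[OF \<sigma>] by (simp flip: o_assoc add: o_assoc)
    show "(\<lambda>\<rho>. \<sigma> \<circ> \<rho>) ` {\<rho>. \<rho> permutes ({1..n} - K)} \<subseteq>
        {\<pi>. \<pi> permutes {1..n} \<and> (\<forall>k\<in>K. \<pi> k = f k)}"
    proof safe
      fix \<rho> assume \<rho>: "\<rho> permutes ({1..n} - K)"
      then have "\<rho> permutes {1..n}"
        by (rule permutes_subset) auto
      then show "\<sigma> \<circ> \<rho> permutes {1..n}"
        using \<sigma> permutes_compose by blast
      show "(\<sigma> \<circ> \<rho>) k = f k" if "k \<in> K" for k
        using that permutes_not_in[OF \<rho>, of k] by (simp add: \<sigma>_def)
    qed
    show "(\<lambda>\<pi>. inv \<sigma> \<circ> \<pi>) ` {\<pi>. \<pi> permutes {1..n} \<and> (\<forall>k\<in>K. \<pi> k = f k)} \<subseteq>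
        {\<rho>. \<rho> permutes ({1..n} - K)}"
    proof safe
      fix \<pi> assume \<pi>: "\<pi> permutes {1..n}" "\<forall>k\<in>K. \<pi> k = f k"
      have 1: "inv \<sigma> \<circ> \<pi> permutes {1..n}"
        using \<pi> \<sigma> permutes_compose permutes_inv by blast
      have "(inv \<sigma> \<circ> \<pi>) k = k" if "k \<in> K" for k
        using that \<pi>(2) permutes_inverses(2)[OF \<sigma>, of k] by (simp add: \<sigma>_def)
      then show "inv \<sigma> \<circ> \<pi> permutes ({1..n} - K)"
        using 1 by (intro permutes_superset[OF 1]) auto
    qed
  qed
  then have "card {\<pi>. \<pi> permutes {1..n} \<and> (\<forall>k\<in>K. \<pi> k = f k)} =
      card {\<rho>. \<rho> permutes ({1..n} - K)}"
    by (simp add: bij_betw_same_card)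
  also have "\<dots> = fact (n - card K)"
    using assms(1) finK by (intro card_permutations) (auto simp: card_Diff_subset)
  finally show ?thesis .
qed

abbreviation prob_perm :: "nat \<Rightarrow> ((nat \<Rightarrow> nat) \<Rightarrow> bool) \<Rightarrow> real" where
  "prob_perm n P \<equiv> measure_pmf.prob (uniform_permutation n) {\<pi>. P \<pi>}"

lemma finite_permutations_upto: "finite {\<pi>. \<pi> permutes {1..n::nat}}"
  by (rule finite_permutations) simp

lemma permutations_upto_nonempty: "{\<pi>. \<pi> permutes {1..n::nat}} \<noteq> {}"
  using permutes_id by blast

lemma set_pmf_uniform_permutation:
  "set_pmf (uniform_permutation n) = {\<pi>. \<pi> permutes {1..n}}"
  unfolding uniform_permutation_def
  by (rule set_pmf_of_set[OF permutations_upto_nonempty finite_permutations_upto])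

lemma integrable_uniform_permutation [simp]:
  "integrable (measure_pmf (uniform_permutation n)) (f :: _ \<Rightarrow> real)"
  by (rule integrable_measure_pmf_finite)
    (simp only: set_pmf_uniform_permutation finite_permutations_upto)

lemma prob_perm_eq_card:
  "prob_perm n P = card {\<pi>. \<pi> permutes {1..n} \<and> P \<pi>} / fact n"
  unfolding uniform_permutation_def
  by (subst measure_pmf_of_set[OF permutations_upto_nonempty finite_permutations_upto])
    (simp add: card_permutations Int_def)

lemma prob_perm_eq_expectation:
  "prob_perm n P = measure_pmf.expectation (uniform_permutation n) (\<lambda>\<pi>. of_bool (P \<pi>))"
proof -
  have "(\<lambda>\<pi>. of_bool (P \<pi>) :: real) = indicator {\<pi>. P \<pi>}"
    by (auto simp: indicator_def)
  then show ?thesis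
    by simp
qed

lemma prob_perm_mono:
  assumes "\<And>\<pi>. \<pi> permutes {1..n} \<Longrightarrow> P \<pi> \<Longrightarrow> Q \<pi>"
  shows "prob_perm n P \<le> prob_perm n Q"
  unfolding prob_perm_eq_card using assms
  by (intro divide_right_mono) (auto intro!: card_mono finite_subset[OF _ finite_permutations_upto[of n]])

text \<open>
  A cell \<open>(i, j)\<close> stands for the event \<open>\<pi> i = j\<close>. In chess terms, rooks placed on the cells
  of such a set do not attack each other.
\<close>

definition nonattacking :: "(nat \<times> nat) set \<Rightarrow> bool" where
  "nonattacking S \<longleftrightarrow> inj_on fst S \<and> inj_on snd S"

text \<open>
  Exact finite-dimensional law of a uniform permutation: it passes through \<open>k\<close> given cells
  with probability \<open>(n - k)! / n!\<close>, unless two of the cells share a row or a column, which is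
  impossible for the graph of an injective function. The Poisson limit and the variance bound both
  rest on this formula.
\<close>

lemma prob_perm_through:
  assumes "S \<subseteq> {1..n} \<times> {1..n}"
  shows "prob_perm n (\<lambda>\<pi>. \<forall>(i, j)\<in>S. \<pi> i = j) =
    (if nonattacking S then fact (n - card S) / fact n else 0)"
proof (cases "nonattacking S")
  case True
  then have inj: "inj_on fst S" "inj_on snd S"
    by (auto simp: nonattacking_def)
  define f where "f = snd \<circ> the_inv_into S fst"
  have f: "f (fst p) = snd p" if "p \<in> S" for p
    using that inj by (simp add: f_def the_inv_into_f_f)
  have "inj_on f (fst ` S)"
    using inj by (auto simp: inj_on_def f)
  moreover have "f ` fst ` S \<subseteq> {1..n}" "fst ` S \<subseteq> {1..n}"
    using assms f by force+
  ultimately have "card {\<pi>. \<pi> permutes {1..n} \<and> (\<forall>k\<in>fst ` S. \<pi> k = f k)} =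
      fact (n - card (fst ` S))"
    by (intro card_permutations_extending)
  moreover have "(\<forall>k\<in>fst ` S. \<pi> k = f k) \<longleftrightarrow> (\<forall>(i, j)\<in>S. \<pi> i = j)" for \<pi>
    using f by fastforce
  ultimately show ?thesis
    using True inj by (simp add: prob_perm_eq_card card_image)
next
  case False
  have "\<not> (\<forall>(i, j)\<in>S. \<pi> i = j)" if "\<pi> permutes {1..n}" for \<pi>
  proof
    assume *: "\<forall>(i, j)\<in>S. \<pi> i = j"
    have "inj \<pi>"
      using that permutes_inj by blast
    then have "p = q" if "p \<in> S" "q \<in> S" "fst p = fst q \<or> snd p = snd q" for p q
    proof -
      have "\<pi> (fst p) = snd p" "\<pi> (fst q) = snd q"
        using * that by auto
      then show ?thesis
        using that(3) \<open>inj \<pi>\<close> by (metis injD prod_eq_iff)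
    qed
    then have "nonattacking S"
      by (auto simp: nonattacking_def inj_on_def)
    with False show False ..
  qed
  then have "{\<pi>. \<pi> permutes {1..n} \<and> (\<forall>(i, j)\<in>S. \<pi> i = j)} = {}"
    by auto
  then show ?thesis
    using False by (simp only: prob_perm_eq_card) simp
qed

section \<open>Poisson limit for avoiding a set of cells\<close>

definition rook_number :: "(nat \<times> nat) set \<Rightarrow> nat \<Rightarrow> nat" where
  "rook_number T k = card {S. S \<subseteq> T \<and> card S = k \<and> nonattacking S}"

lemma nonattacking_subset: "nonattacking S \<Longrightarrow> S' \<subseteq> S \<Longrightarrow> nonattacking S'"
  by (auto simp: nonattacking_def intro: inj_on_subset)

lemma nonattacking_card_le:
  assumes "S \<subseteq> {1..n} \<times> {1..n}" "nonattacking S"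
  shows "card S \<le> n"
proof -
  have "card S = card (fst ` S)"
    using assms(2) by (simp add: nonattacking_def card_image)
  also have "\<dots> \<le> card {1..n}"
    using assms(1) by (intro card_mono) auto
  finally show ?thesis by simp
qed

lemma rook_number_0 [simp]: 
  assumes "finite T" shows "rook_number T 0 = 1"
proof -
  have "{S. S \<subseteq> T \<and> card S = 0 \<and> nonattacking S} = {{}}"
    using assms by (auto simp: nonattacking_def dest: finite_subset)
  then show ?thesis by (simp add: rook_number_def)
qed

text \<open>
  Double counting of the pairs consisting of a placement of \<open>k + 1\<close> rooks and one distinguished
  rook: removing the distinguished rook leaves a placement of \<open>k\<close> rooks together with a free
  cell. Bounding the number of free cells gives the two inequalities that follow.
\<close>

lemma rook_number_Suc:
  assumes "finite T"
  shows "Suc k * rook_number T (Suc k) =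
    (\<Sum>S | S \<subseteq> T \<and> card S = k \<and> nonattacking S. card {p \<in> T - S. nonattacking (insert p S)})"
proof -
  define R where "R = (\<lambda>k. {S. S \<subseteq> T \<and> card S = k \<and> nonattacking S})"
  have fin: "finite (R k)" for k
    using assms by (auto simp: R_def)
  have finS: "finite S" if "S \<in> R k" for S k
    using that assms finite_subset by (auto simp: R_def)
  have "bij_betw (\<lambda>(S, p). (S - {p}, p)) (SIGMA S:R (Suc k). S)
      (SIGMA S:R k. {p \<in> T - S. nonattacking (insert p S)})"
  proof (rule bij_betw_byWitness[where f' = "\<lambda>(S, p). (insert p S, p)"])
    show "(\<lambda>(S, p). (S - {p}, p)) ` (SIGMA S:R (Suc k). S) \<subseteq>
        (SIGMA S:R k. {p \<in> T - S. nonattacking (insert p S)})"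
      by (auto simp: R_def insert_absorb intro: nonattacking_subset)
    show "(\<lambda>(S, p). (insert p S, p)) ` (SIGMA S:R k. {p \<in> T - S. nonattacking (insert p S)})
        \<subseteq> (SIGMA S:R (Suc k). S)"
    proof
      fix x assume "x \<in> (\<lambda>(S, p). (insert p S, p)) `
        (SIGMA S:R k. {p \<in> T - S. nonattacking (insert p S)})"
      then obtain S p where "x = (insert p S, p)" "S \<in> R k" "p \<in> T" "p \<notin> S"
          "nonattacking (insert p S)"
        by auto
      with finS[of S k] show "x \<in> (SIGMA S:R (Suc k). S)"
        by (simp add: R_def)
    qed
  qed auto
  then have "card (SIGMA S:R (Suc k). S) =
      card (SIGMA S:R k. {p \<in> T - S. nonattacking (insert p S)})"
    by (rule bij_betw_same_card)
  moreover have "card (SIGMA S:R (Suc k). S) = (\<Sum>S\<in>R (Suc k). card S)"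
    using fin finS by (intro card_SigmaI) auto
  moreover have "\<dots> = Suc k * rook_number T (Suc k)"
    by (simp add: R_def rook_number_def)
  moreover have "card (SIGMA S:R k. {p \<in> T - S. nonattacking (insert p S)}) =
      (\<Sum>S\<in>R k. card {p \<in> T - S. nonattacking (insert p S)})"
    using fin assms by (intro card_SigmaI) auto
  ultimately show ?thesis
    by (simp add: R_def)
qed

lemma rook_number_Suc_le:
  assumes "finite T"
  shows "Suc k * rook_number T (Suc k) \<le> card T * rook_number T k"
proof -
  have "(\<Sum>S | S \<subseteq> T \<and> card S = k \<and> nonattacking S. card {p \<in> T - S. nonattacking (insert p S)})
      \<le> (\<Sum>S | S \<subseteq> T \<and> card S = k \<and> nonattacking S. card T)"
    using assms by (intro sum_mono card_mono) auto
  then show ?thesis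
    unfolding rook_number_Suc[OF assms] by (simp add: rook_number_def mult.commute)
qed

text \<open>
  Each of the \<open>k\<close> rooks blocks only its row and its column, hence at most \<open>2 w\<close> cells.
\<close>

lemma rook_number_Suc_ge:
  assumes "finite T"
    and row: "\<And>i. card {p \<in> T. fst p = i} \<le> w" and col: "\<And>j. card {p \<in> T. snd p = j} \<le> w"
  shows "(real (card T) - 2 * real k * real w) * real (rook_number T k)
           \<le> real (Suc k) * real (rook_number T (Suc k))"
proof -
  have *: "real (card T) - 2 * real k * real w \<le> real (card {p \<in> T - S. nonattacking (insert p S)})"
    if S: "S \<subseteq> T" "card S = k" "nonattacking S" for S
  proof -
    have finS: "finite S"
      using S(1) assms(1) by (rule finite_subset)
    define A where "A = (\<Union>q\<in>S. {p \<in> T. fst p = fst q} \<union> {p \<in> T. snd p = snd q})"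
    have "card A \<le> (\<Sum>q\<in>S. card ({p \<in> T. fst p = fst q} \<union> {p \<in> T. snd p = snd q}))"
      unfolding A_def by (rule card_UN_le[OF finS])
    also have "\<dots> \<le> (\<Sum>q\<in>S. w + w)"
      by (intro sum_mono order_trans[OF card_Un_le] add_mono row col)
    finally have A: "card A \<le> 2 * k * w"
      using S by (simp add: algebra_simps)
    have "T - A \<subseteq> {p \<in> T - S. nonattacking (insert p S)}"
      using S by (force simp: A_def nonattacking_def inj_on_insert image_iff)
    then have "card (T - A) \<le> card {p \<in> T - S. nonattacking (insert p S)}"
      using assms(1) by (intro card_mono) auto
    moreover have "card T - card A \<le> card (T - A)"
      by (rule diff_card_le_card_Diff) (use assms(1) finS in \<open>auto simp: A_def\<close>)
    ultimately have "card T \<le> card {p \<in> T - S. nonattacking (insert p S)} + 2 * k * w"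
      using A by linarith
    then have "real (card T) \<le> real (card {p \<in> T - S. nonattacking (insert p S)} + 2 * k * w)"
      by (rule of_nat_mono)
    then show ?thesis
      by (simp add: algebra_simps)
  qed
  have "(real (card T) - 2 * real k * real w) * real (rook_number T k) =
      (\<Sum>S | S \<subseteq> T \<and> card S = k \<and> nonattacking S. real (card T) - 2 * real k * real w)"
    by (simp add: rook_number_def)
  also have "\<dots> \<le> (\<Sum>S | S \<subseteq> T \<and> card S = k \<and> nonattacking S.
      real (card {p \<in> T - S. nonattacking (insert p S)}))"
    by (intro sum_mono *) auto
  also have "\<dots> = real (Suc k * rook_number T (Suc k))"
    by (simp only: rook_number_Suc[OF assms(1)] of_nat_sum)
  also have "\<dots> = real (Suc k) * real (rook_number T (Suc k))"
    by (rule of_nat_mult)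
  finally show ?thesis .
qed

lemma rook_number_le:
  assumes "finite T"
  shows "real (rook_number T k) \<le> real (card T) ^ k / fact k"
proof (induction k)
  case (Suc k)
  have "real (Suc k) * real (rook_number T (Suc k)) \<le> real (card T) * real (rook_number T k)"
    using rook_number_Suc_le[OF assms, of k] by (metis of_nat_mono of_nat_mult)
  also have "\<dots> \<le> real (card T) * (real (card T) ^ k / fact k)"
    by (intro mult_left_mono Suc) auto
  finally show ?case
    by (simp add: field_simps del: of_nat_Suc)
qed (use assms in auto)

text \<open>
  When the lines of the boards are thin (\<open>w n = o(n)\<close>), attacking pairs are negligible, and
  placing \<open>k\<close> rooks is asymptotically the same as choosing \<open>k\<close> cells. By induction on
  \<open>k\<close>, with the two bounds on the number of ways to add a rook as the step.
\<close>

lemma rook_number_asymp: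
  assumes fin: "\<And>n. finite (T n)"
    and row: "\<And>n i. card {p \<in> T n. fst p = i} \<le> w n"
    and col: "\<And>n j. card {p \<in> T n. snd p = j} \<le> w n"
    and w: "(\<lambda>n. real (w n) / real n) \<longlonglongrightarrow> 0"
    and T: "(\<lambda>n. real (card (T n)) / real n) \<longlonglongrightarrow> \<theta>"
  shows "(\<lambda>n. real (rook_number (T n) k) / real n ^ k) \<longlonglongrightarrow> \<theta> ^ k / fact k"
proof (induction k)
  case 0
  show ?case using fin by simp
next
  case (Suc k)
  let ?r = "\<lambda>n. real (rook_number (T n) k) / real n ^ k"
  let ?t = "\<lambda>n. real (card (T n)) / real n"
  have up: "(\<lambda>n. ?t n * ?r n / real (Suc k)) \<longlonglongrightarrow> \<theta> * (\<theta> ^ k / fact k) / real (Suc k)"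
    by (intro tendsto_intros T Suc) auto
  have lo: "(\<lambda>n. (?t n - 2 * real k * (real (w n) / real n)) * ?r n / real (Suc k))
      \<longlonglongrightarrow> (\<theta> - 2 * real k * 0) * (\<theta> ^ k / fact k) / real (Suc k)"
    by (intro tendsto_intros T Suc w) auto
  have "(\<lambda>n. real (rook_number (T n) (Suc k)) / real n ^ Suc k)
      \<longlonglongrightarrow> \<theta> * (\<theta> ^ k / fact k) / real (Suc k)"
  proof (rule tendsto_sandwich[OF _ _ _ up])
    show "(\<lambda>n. (?t n - 2 * real k * (real (w n) / real n)) * ?r n / real (Suc k))
      \<longlonglongrightarrow> \<theta> * (\<theta> ^ k / fact k) / real (Suc k)"
      using lo by simp
    show "\<forall>\<^sub>F n in sequentially. (?t n - 2 * real k * (real (w n) / real n)) * ?r n / real (Suc k)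
        \<le> real (rook_number (T n) (Suc k)) / real n ^ Suc k"
      using eventually_gt_at_top[of 0]
    proof eventually_elim
      case (elim n)
      have "(?t n - 2 * real k * (real (w n) / real n)) * ?r n / real (Suc k) =
          ((real (card (T n)) - 2 * real k * real (w n)) * real (rook_number (T n) k)) /
          (real (Suc k) * real n ^ Suc k)"
        using elim by (simp add: field_simps)
      also have "\<dots> \<le> (real (Suc k) * real (rook_number (T n) (Suc k))) / (real (Suc k) * real n ^ Suc k)"
        by (intro divide_right_mono rook_number_Suc_ge fin row col) auto
      finally show ?case
        by simp
    qed
    show "\<forall>\<^sub>F n in sequentially. real (rook_number (T n) (Suc k)) / real n ^ Suc k
        \<le> ?t n * ?r n / real (Suc k)"
      using eventually_gt_at_top[of 0]
    proof eventually_elim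
      case (elim n)
      have "real (rook_number (T n) (Suc k)) / real n ^ Suc k =
          real (Suc k * rook_number (T n) (Suc k)) / (real (Suc k) * real n ^ Suc k)"
        by (simp del: of_nat_Suc mult_Suc)
      also have "\<dots> \<le> real (card (T n) * rook_number (T n) k) / (real (Suc k) * real n ^ Suc k)"
        by (intro divide_right_mono of_nat_mono rook_number_Suc_le fin) auto
      also have "\<dots> = ?t n * ?r n / real (Suc k)"
        by (simp add: field_simps)
      finally show ?case .
    qed
  qed
  then show ?case
    by (simp add: field_simps)
qed

text \<open>
  The classical inclusion--exclusion formula for permutations with forbidden positions.
\<close>

lemma prob_perm_avoid:
  assumes T: "T \<subseteq> {1..n} \<times> {1..n}"
  shows "prob_perm n (\<lambda>\<pi>. \<forall>(i, j)\<in>T. \<pi> i \<noteq> j) =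
    (\<Sum>k\<le>n. (- 1) ^ k * real (rook_number T k) * fact (n - k) / fact n)"
proof -
  have finT: "finite T"
    using T finite_subset by blast
  have *: "of_bool (\<forall>(i, j)\<in>T. \<pi> i \<noteq> j) =
      (\<Sum>S\<in>Pow T. (- 1) ^ card S * of_bool (\<forall>(i, j)\<in>S. \<pi> i = j) :: real)" for \<pi> :: "nat \<Rightarrow> nat"
  proof -
    have "of_bool (\<forall>(i, j)\<in>T. \<pi> i \<noteq> j) = (\<Prod>p\<in>T. 1 - of_bool (\<pi> (fst p) = snd p) :: real)"
    proof (cases "\<forall>(i, j)\<in>T. \<pi> i \<noteq> j")
      case True
      then have "(\<Prod>p\<in>T. 1 - of_bool (\<pi> (fst p) = snd p) :: real) = 1"
        by (intro prod.neutral) auto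
      with True show ?thesis by simp
    next
      case False
      then obtain p where "p \<in> T" "\<pi> (fst p) = snd p"
        by force
      then have "(\<Prod>p\<in>T. 1 - of_bool (\<pi> (fst p) = snd p) :: real) = 0"
        using finT by (intro prod_zero) auto
      with False show ?thesis by simp
    qed
    also have "\<dots> = (\<Sum>S\<in>Pow T. (- 1) ^ card S * (\<Prod>p\<in>S. of_bool (\<pi> (fst p) = snd p)))"
      using finT by (subst prod_diff_conv_sum) auto
    also have "\<dots> = (\<Sum>S\<in>Pow T. (- 1) ^ card S * of_bool (\<forall>(i, j)\<in>S. \<pi> i = j))"
    proof (intro sum.cong refl arg_cong2[where f = "(*)"])
      fix S assume "S \<in> Pow T"
      then have "finite S"
        using finT finite_subset by auto
      then show "(\<Prod>p\<in>S. of_bool (\<pi> (fst p) = snd p)) = (of_bool (\<forall>(i, j)\<in>S. \<pi> i = j) :: real)"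
        by (induction S rule: finite_induct) auto
    qed
    finally show ?thesis .
  qed
  let ?N = "{S \<in> Pow T. nonattacking S}"
  have "prob_perm n (\<lambda>\<pi>. \<forall>(i, j)\<in>T. \<pi> i \<noteq> j) =
      (\<Sum>S\<in>Pow T. (- 1) ^ card S * prob_perm n (\<lambda>\<pi>. \<forall>(i, j)\<in>S. \<pi> i = j))"
    unfolding prob_perm_eq_expectation *
    by (subst Bochner_Integration.integral_sum) (simp_all del: of_bool_eq_iff)
  also have "\<dots> = (\<Sum>S\<in>Pow T. if nonattacking S then (- 1) ^ card S * (fact (n - card S) / fact n) else 0)"
    using T by (intro sum.cong refl) (subst prob_perm_through, auto)
  also have "\<dots> = (\<Sum>S\<in>?N. (- 1) ^ card S * (fact (n - card S) / fact n))"
    by (rule sum.inter_filter[symmetric]) (use finT in simp)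
  also have "\<dots> = (\<Sum>k\<le>n. \<Sum>S | S \<in> ?N \<and> card S = k. (- 1) ^ card S * (fact (n - card S) / fact n))"
    using finT T nonattacking_card_le[of _ n] by (intro sum.group[symmetric]) auto
  also have "\<dots> = (\<Sum>k\<le>n. (- 1) ^ k * real (rook_number T k) * fact (n - k) / fact n)"
  proof (intro sum.cong refl)
    fix k
    have "(\<Sum>S | S \<in> ?N \<and> card S = k. (- 1) ^ card S * (fact (n - card S) / fact n)) =
        (\<Sum>S | S \<in> ?N \<and> card S = k. (- 1) ^ k * (fact (n - k) / fact n :: real))"
      by (intro sum.cong) auto
    also have "{S. S \<in> ?N \<and> card S = k} = {S. S \<subseteq> T \<and> card S = k \<and> nonattacking S}"
      by auto
    finally show "(\<Sum>S | S \<in> ?N \<and> card S = k. (- 1) ^ card S * (fact (n - card S) / fact n)) =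
        (- 1) ^ k * real (rook_number T k) * fact (n - k) / (fact n :: real)"
      by (simp add: rook_number_def conj_ac)
  qed
  finally show ?thesis .
qed

text \<open>
  A lower bound for falling factorials, \<open>n (n - 1) ... (n - k + 1) \<ge> (n / e)^k\<close>, valid up to
  \<open>k = n\<close>. It supplies the summable majorant \<open>(c e)^k / k!\<close> in the passage to the limit in the
  inclusion--exclusion formula.
\<close>

lemma power_mult_fact_le:
  assumes "k \<le> n"
  shows "real n ^ k * fact (n - k) \<le> exp (real k) * fact n"
  using assms
proof (induction n arbitrary: k)
  case (Suc n)
  show ?case
  proof (cases k)
    case (Suc l)
    with Suc.prems have l: "l \<le> n" by simp
    \<comment> \<open>Because \<open>(1 + 1 / n)^l \<le> exp (l / n)\<close> and \<open>l \<le> n\<close>.\<close>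
    have "(real n + 1) ^ l \<le> exp 1 * real n ^ l"
    proof (cases "n = 0")
      case False
      have "(real n + 1) ^ l = (1 + 1 / real n) ^ l * real n ^ l"
        using False by (simp add: field_simps flip: power_mult_distrib)
      also have "\<dots> \<le> exp (1 / real n) ^ l * real n ^ l"
        by (intro mult_right_mono power_mono exp_ge_add_one_self) auto
      also have "\<dots> \<le> exp 1 * real n ^ l"
        using l False by (intro mult_right_mono) (simp_all add: field_simps flip: exp_of_nat_mult)
      finally show ?thesis .
    qed (use l in auto)
    then have "(real n + 1) ^ l * fact (n - l) \<le> exp 1 * real n ^ l * fact (n - l)"
      by (rule mult_right_mono) simp
    also have "\<dots> = exp 1 * (real n ^ l * fact (n - l))"
      by (rule mult.assoc)
    also have "\<dots> \<le> exp 1 * (exp (real l) * fact n)"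
      by (intro mult_left_mono Suc.IH l) auto
    also have "\<dots> = exp (real k) * fact n"
      by (simp add: Suc exp_add mult_ac)
    finally have "(real n + 1) * ((real n + 1) ^ l * fact (n - l)) \<le> (real n + 1) * (exp (real k) * fact n)"
      by (intro mult_left_mono) auto
    then show ?thesis
      by (simp add: Suc algebra_simps)
  qed simp
qed simp

lemma power_mult_fact_asymp: "(\<lambda>n. real n ^ k * fact (n - k) / fact n) \<longlonglongrightarrow> 1"
proof (induction k)
  case (Suc k)
  have "(\<lambda>n. real n / (real n - real k)) \<longlonglongrightarrow> 1"
    by real_asymp
  from tendsto_mult[OF Suc this]
  have "(\<lambda>n. real n ^ k * fact (n - k) / fact n * (real n / (real n - real k))) \<longlonglongrightarrow> 1"
    by simp
  then show ?case
  proof (rule Lim_transform_eventually)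
    show "\<forall>\<^sub>F n in sequentially. real n ^ k * fact (n - k) / fact n * (real n / (real n - real k)) =
        real n ^ Suc k * fact (n - Suc k) / fact n"
      using eventually_gt_at_top[of k]
    proof eventually_elim
      case (elim n)
      then have "n - k = Suc (n - Suc k)" by simp
      then have "fact (n - k) = (real n - real k) * fact (n - Suc k)"
        using elim by (simp add: of_nat_diff)
      moreover have "real n - real k \<noteq> 0"
        using elim by simp
      ultimately show ?case
        by simp
    qed
  qed
qed simp

text \<open>
  Poisson limit for the number of cells of \<open>T n\<close> that the permutation meets: the expected number
  tends to \<open>\<theta>\<close>, and since the lines of \<open>T n\<close> are thin, the cells behave as if they were hit
  independently. The \<open>k\<close>-th term of the inclusion--exclusion formula tends to
  \<open>(- \<theta>)^k / k!\<close>, and Tannery's theorem allows summing these limits.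
\<close>

theorem prob_perm_avoid_limit:
  assumes sub: "\<And>n. T n \<subseteq> {1..n} \<times> {1..n}"
    and row: "\<And>n i. card {p \<in> T n. fst p = i} \<le> w n"
    and col: "\<And>n j. card {p \<in> T n. snd p = j} \<le> w n"
    and w: "(\<lambda>n. real (w n) / real n) \<longlonglongrightarrow> 0"
    and T: "(\<lambda>n. real (card (T n)) / real n) \<longlonglongrightarrow> \<theta>"
  shows "(\<lambda>n. prob_perm n (\<lambda>\<pi>. \<forall>(i, j)\<in>T n. \<pi> i \<noteq> j)) \<longlonglongrightarrow> exp (- \<theta>)"
proof -
  have fin: "finite (T n)" for n
    using sub finite_subset by blast
  define a where "a = (\<lambda>k n. if k \<le> n
    then (- 1) ^ k * real (rook_number (T n) k) * fact (n - k) / fact n else 0 :: real)"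
  obtain c where c: "c > 0" "\<And>n. norm (real (card (T n)) / real n) \<le> c"
    using convergent_imp_Bseq[OF convergentI[OF T]] BseqE by blast
  define M where "M = (\<lambda>k. inverse (fact k) * (c * exp 1) ^ k)"
  have "((\<lambda>n. suminf (\<lambda>k. a k n)) \<longlonglongrightarrow> (\<Sum>k. (- \<theta>) ^ k / fact k))"
  proof (rule tannerys_theorem[THEN conjunct2, THEN conjunct2])
    show "(\<lambda>n. a k n) \<longlonglongrightarrow> (- \<theta>) ^ k / fact k" for k
    proof -
      have "(\<lambda>n. (- 1) ^ k * (real (rook_number (T n) k) / real n ^ k) *
          (real n ^ k * fact (n - k) / fact n)) \<longlonglongrightarrow> (- 1) ^ k * (\<theta> ^ k / fact k) * 1"
        by (intro tendsto_intros power_mult_fact_asymp rook_number_asymp[OF fin row col w T])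
      also have "(- 1) ^ k * (\<theta> ^ k / fact k) * 1 = (- \<theta>) ^ k / fact k"
        by (simp add: power_minus')
      finally show ?thesis
      proof (rule Lim_transform_eventually)
        show "\<forall>\<^sub>F n in sequentially. (- 1) ^ k * (real (rook_number (T n) k) / real n ^ k) *
          (real n ^ k * fact (n - k) / fact n) = a k n"
          using eventually_ge_at_top[of "max 1 k"]
          by eventually_elim (simp add: a_def)
      qed
    qed
    have "norm (a k n) \<le> M k" if n: "n > 0" for k n
    proof (cases "k \<le> n")
      case True
      have "norm (a k n) = real (rook_number (T n) k) * (fact (n - k) / fact n)"
        using True by (simp add: a_def abs_mult)
      also have "\<dots> \<le> real (card (T n)) ^ k / fact k * (exp (real k) / real n ^ k)"
        using power_mult_fact_le[OF True] n
        by (intro mult_mono rook_number_le fin) (auto simp: field_simps)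
      also have "\<dots> = (real (card (T n)) / real n) ^ k * exp 1 ^ k / fact k"
        by (simp add: power_divide flip: exp_of_nat_mult)
      also have "\<dots> \<le> c ^ k * exp 1 ^ k / fact k"
        using c(2)[of n] by (intro divide_right_mono mult_right_mono power_mono) auto
      finally show ?thesis
        by (simp add: M_def power_mult_distrib field_simps)
    qed (use c in \<open>simp add: a_def M_def\<close>)
    then show "\<forall>\<^sub>F (k, n) in sequentially \<times>\<^sub>F sequentially. norm (a k n) \<le> M k"
      by (intro eventually_prodI[THEN eventually_mono, of "\<lambda>_. True" _ "\<lambda>n. n > 0"])
        (auto simp: eventually_gt_at_top)
    show "summable M"
      unfolding M_def by (rule summable_exp)
  qed simp
  also have "(\<Sum>k. (- \<theta>) ^ k / fact k) = exp (- \<theta>)"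
    by (simp add: exp_def field_simps)
  also have "(\<lambda>n. suminf (\<lambda>k. a k n)) = (\<lambda>n. prob_perm n (\<lambda>\<pi>. \<forall>(i, j)\<in>T n. \<pi> i \<noteq> j))"
  proof
    fix n
    have "suminf (\<lambda>k. a k n) = (\<Sum>k\<le>n. a k n)"
      by (rule suminf_finite) (auto simp: a_def)
    then show "suminf (\<lambda>k. a k n) = prob_perm n (\<lambda>\<pi>. \<forall>(i, j)\<in>T n. \<pi> i \<noteq> j)"
      unfolding prob_perm_avoid[OF sub] by (simp add: a_def)
  qed
  finally show ?thesis .
qed

section \<open>Concentration of the number of points in a box\<close>

lemma prob_perm_through_1:
  assumes "i \<in> {1..n}" "j \<in> {1..n}"
  shows "prob_perm n (\<lambda>\<pi>. \<pi> i = j) = 1 / real n"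
proof -
  have "n = Suc (n - 1)" using assms by auto
  then have "fact n = real n * fact (n - 1)"
    by (metis fact_Suc of_nat_id)
  then show ?thesis
    using prob_perm_through[of "{(i, j)}" n] assms by (simp add: nonattacking_def)
qed

lemma prob_perm_through_2:
  assumes "{i, k} \<subseteq> {1..n}" "{j, l} \<subseteq> {1..n}" "i \<noteq> k" "j \<noteq> l"
  shows "prob_perm n (\<lambda>\<pi>. \<pi> i = j \<and> \<pi> k = l) = 1 / (real n * (real n - 1))"
proof -
  have "n \<ge> 2" using assms by auto
  then obtain m where n: "n = Suc (Suc m)" by (metis add_2_eq_Suc le_Suc_ex)
  show ?thesis
    using prob_perm_through[of "{(i, j), (k, l)}" n] assms
    by (simp add: nonattacking_def n)
qed

lemma prob_perm_through_3:
  assumes "{i, k, k'} \<subseteq> {1..n}" "{j, l, l'} \<subseteq> {1..n}" "i \<noteq> k" "j \<noteq> l" "i \<noteq> k'" "j \<noteq> l'"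
    "k \<noteq> k'" "l \<noteq> l'"
  shows "prob_perm n (\<lambda>\<pi>. \<pi> i = j \<and> \<pi> k = l \<and> \<pi> k' = l') =
    1 / (real n * (real n - 1) * (real n - 2))"
proof -
  have "n \<ge> 3" using assms by auto
  then obtain m where n: "n = Suc (Suc (Suc m))" 
    by (metis add.commute le_Suc_ex numeral_3_eq_3 add_Suc_right add_0_right)
  show ?thesis
    using prob_perm_through[of "{(i, j), (k, l), (k', l')}" n] assms
    by (simp add: nonattacking_def n)
qed

text \<open>
  Summing over all cells \<open>q\<close> for fixed \<open>p\<close>: the cell \<open>q = p\<close> gives the first summand, cells
  that share exactly one line with \<open>p\<close> are impossible, and the other
  \<open>(\<bar>R\<bar> - 1) (\<bar>L\<bar> - 1)\<close> cells give the second summand.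
\<close>

lemma prob_perm_box_pairs:
  assumes ij: "i \<in> {1..n}" "j \<in> {1..n}" and R: "R \<subseteq> {1..n} - {i}" and L: "L \<subseteq> {1..n} - {j}"
    and p: "p \<in> R \<times> L"
  shows "(\<Sum>q\<in>R \<times> L. prob_perm n (\<lambda>\<pi>. \<pi> i = j \<and> \<pi> (fst p) = snd p \<and> \<pi> (fst q) = snd q)) =
    1 / (real n * (real n - 1)) +
    (real (card R) - 1) * (real (card L) - 1) / (real n * (real n - 1) * (real n - 2))"
proof -
  have fin: "finite R" "finite L"
    using R L finite_subset by blast+
  define A where "A = (R - {fst p}) \<times> (L - {snd p})"
  let ?f = "\<lambda>q. prob_perm n (\<lambda>\<pi>. \<pi> i = j \<and> \<pi> (fst p) = snd p \<and> \<pi> (fst q) = snd q)"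
  have "?f q = 0" if q: "q \<in> R \<times> L - insert p A" for q
  proof -
    have "\<not> (\<pi> (fst p) = snd p \<and> \<pi> (fst q) = snd q)" if \<pi>: "\<pi> permutes {1..n}" for \<pi>
    proof
      assume *: "\<pi> (fst p) = snd p \<and> \<pi> (fst q) = snd q"
      have "p \<noteq> q" "fst p = fst q \<or> snd p = snd q"
        using q by (auto simp: A_def mem_Times_iff)
      with * permutes_inj[OF \<pi>] show False
        by (metis injD prod_eq_iff)
    qed
    then have "{\<pi>. \<pi> permutes {1..n} \<and> \<pi> i = j \<and> \<pi> (fst p) = snd p \<and> \<pi> (fst q) = snd q} = {}"
      by blast
    then show ?thesis
      by (simp only: prob_perm_eq_card) simp
  qed
  then have "(\<Sum>q\<in>R \<times> L. ?f q) = (\<Sum>q\<in>insert p A. ?f q)"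
    using fin p by (intro sum.mono_neutral_right) (auto simp: A_def)
  also have "\<dots> = ?f p + (\<Sum>q\<in>A. ?f q)"
    using fin by (intro sum.insert) (auto simp: A_def)
  also have "?f p = prob_perm n (\<lambda>\<pi>. \<pi> i = j \<and> \<pi> (fst p) = snd p)"
    by simp
  also have "\<dots> = 1 / (real n * (real n - 1))"
    using ij R L p by (intro prob_perm_through_2) auto
  also have "(\<Sum>q\<in>A. ?f q) = (\<Sum>q\<in>A. 1 / (real n * (real n - 1) * (real n - 2)))"
    using ij R L p by (intro sum.cong refl prob_perm_through_3) (auto simp: A_def)
  also have "\<dots> = (real (card R) - 1) * (real (card L) - 1) / (real n * (real n - 1) * (real n - 2))"
  proof -
    have "card R > 0" "card L > 0"
      using p fin by (auto simp: card_gt_0_iff)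
    then have "real (card A) = (real (card R) - 1) * (real (card L) - 1)"
      using p by (auto simp: A_def card_cartesian_product mem_Times_iff of_nat_diff)
    then show ?thesis
      by simp
  qed
  finally show ?thesis .
qed

text \<open>
  Given \<open>\<pi> i = j\<close>, the number of points of \<open>\<pi>\<close> in the box \<open>R \<times> L\<close> is hypergeometric
  with mean \<open>\<mu>\<close>, and sampling without replacement makes its variance at most \<open>\<mu>\<close>. The factor
  \<open>1 / n\<close> is the probability of \<open>\<pi> i = j\<close>. The conditional distribution is never formed: the
  moments are taken against the indicator of \<open>\<pi> i = j\<close>.
\<close>

lemma chebyshev_box_count:
  fixes x :: real
  assumes n: "n \<ge> 3" and ij: "i \<in> {1..n}" "j \<in> {1..n}"
    and R: "R \<subseteq> {1..n} - {i}" and L: "L \<subseteq> {1..n} - {j}"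
    and \<mu>: "\<mu> = real (card R) * real (card L) / (real n - 1)" and x: "\<mu> < x"
  shows "prob_perm n (\<lambda>\<pi>. \<pi> i = j \<and> x \<le> real (card {k \<in> R. \<pi> k \<in> L})) \<le> \<mu> / (real n * (x - \<mu>)\<^sup>2)"
proof -
  let ?E = "measure_pmf.expectation (uniform_permutation n)"
  let ?C = "\<lambda>\<pi>. real (card {k \<in> R. \<pi> k \<in> L})"
  let ?B = "\<lambda>\<pi>. of_bool (\<pi> i = j) :: real"
  define s where "s = real (card R)"
  define t where "t = real (card L)"
  define N where "N = real n - 1"
  have N: "N \<ge> 2" "real n = N + 1" using n by (auto simp: N_def)
  have fin: "finite R" "finite L"
    using R L finite_subset by blast+
  have "card R \<le> card ({1..n} - {i})" "card L \<le> card ({1..n} - {j})"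
    using R L by (auto intro!: card_mono)
  then have st: "s \<le> N" "t \<le> N" "s \<ge> 0" "t \<ge> 0"
    using ij n by (auto simp: s_def t_def N_def)
  have C: "?C \<pi> = (\<Sum>p\<in>R \<times> L. of_bool (\<pi> (fst p) = snd p))" for \<pi>
  proof -
    have "?C \<pi> = (\<Sum>k\<in>R. of_bool (\<pi> k \<in> L))"
      using fin by (simp add: Int_def)
    also have "\<dots> = (\<Sum>k\<in>R. \<Sum>l\<in>L. of_bool (\<pi> k = l))"
      using fin by (intro sum.cong refl) (simp add: of_bool_def)
    finally show ?thesis
      by (simp add: sum.cartesian_product case_prod_beta)
  qed
  have E0: "?E ?B = 1 / (N + 1)"
    using prob_perm_through_1[OF ij] N by (simp only: prob_perm_eq_expectation)
  have E1: "?E (\<lambda>\<pi>. ?B \<pi> * ?C \<pi>) = s * t / ((N + 1) * N)"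
  proof -
    have "?E (\<lambda>\<pi>. ?B \<pi> * ?C \<pi>) = (\<Sum>p\<in>R \<times> L. prob_perm n (\<lambda>\<pi>. \<pi> i = j \<and> \<pi> (fst p) = snd p))"
      unfolding C sum_distrib_left prob_perm_eq_expectation
      by (subst Bochner_Integration.integral_sum) (simp_all add: of_bool_conj)
    also have "\<dots> = (\<Sum>p\<in>R \<times> L. 1 / (real n * (real n - 1)))"
      using ij R L by (intro sum.cong refl prob_perm_through_2) auto
    finally show ?thesis
      by (simp add: card_cartesian_product s_def t_def N)
  qed
  have E2: "?E (\<lambda>\<pi>. ?B \<pi> * (?C \<pi>)\<^sup>2) =
      s * t * (1 / ((N + 1) * N) + (s - 1) * (t - 1) / ((N + 1) * N * (N - 1)))"
  proof -
    have *: "?B \<pi> * (?C \<pi>)\<^sup>2 = (\<Sum>p\<in>R \<times> L. \<Sum>q\<in>R \<times> L.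
        of_bool (\<pi> i = j \<and> \<pi> (fst p) = snd p \<and> \<pi> (fst q) = snd q))" for \<pi>
      unfolding C power2_eq_square sum_product by (simp only: sum_distrib_left of_bool_conj)
    have "?E (\<lambda>\<pi>. ?B \<pi> * (?C \<pi>)\<^sup>2) = (\<Sum>p\<in>R \<times> L. \<Sum>q\<in>R \<times> L.
        prob_perm n (\<lambda>\<pi>. \<pi> i = j \<and> \<pi> (fst p) = snd p \<and> \<pi> (fst q) = snd q))"
      unfolding * prob_perm_eq_expectation
      by (simp only: Bochner_Integration.integral_sum integrable_uniform_permutation)
    also have "\<dots> = (\<Sum>p\<in>R \<times> L. 1 / (real n * (real n - 1)) +
        (real (card R) - 1) * (real (card L) - 1) / (real n * (real n - 1) * (real n - 2)))"
      by (intro sum.cong refl prob_perm_box_pairs ij R L)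
    also have "\<dots> = s * t * (1 / ((N + 1) * N) + (s - 1) * (t - 1) / ((N + 1) * N * (N - 1)))"
      by (simp add: card_cartesian_product s_def t_def N)
    finally show ?thesis .
  qed
  have \<mu>': "\<mu> = s * t / N"
    by (simp add: \<mu> s_def t_def N_def)
  have "?E (\<lambda>\<pi>. ?B \<pi> * (?C \<pi> - \<mu>)\<^sup>2) =
      ?E (\<lambda>\<pi>. ?B \<pi> * (?C \<pi>)\<^sup>2 - 2 * \<mu> * (?B \<pi> * ?C \<pi>) + \<mu>\<^sup>2 * ?B \<pi>)"
    by (intro Bochner_Integration.integral_cong) (auto simp: power2_eq_square algebra_simps)
  also have "\<dots> = ?E (\<lambda>\<pi>. ?B \<pi> * (?C \<pi>)\<^sup>2) - 2 * \<mu> * ?E (\<lambda>\<pi>. ?B \<pi> * ?C \<pi>) + \<mu>\<^sup>2 * ?E ?B"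
    by (simp add: Bochner_Integration.integral_add Bochner_Integration.integral_diff)
  also have "\<dots> = (\<mu> + s * t * ((s - 1) * (t - 1)) / (N * (N - 1)) - \<mu>\<^sup>2) / (N + 1)"
  proof -
    have "s * t * (1 / ((N + 1) * N) + (s - 1) * (t - 1) / ((N + 1) * N * (N - 1))) =
        (\<mu> + s * t * ((s - 1) * (t - 1)) / (N * (N - 1))) / (N + 1)"
      unfolding \<mu>' by (simp only: distrib_left add_divide_distrib divide_divide_eq_left
          times_divide_eq_right mult_1_right mult.assoc mult.commute mult.left_commute)
    moreover have "2 * \<mu> * (s * t / ((N + 1) * N)) = 2 * \<mu>\<^sup>2 / (N + 1)"
      by (simp add: \<mu>' power2_eq_square mult_ac)
    ultimately show ?thesis
      unfolding E0 E1 E2 by (simp add: add_divide_distrib diff_divide_distrib)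
  qed
  also have "\<dots> \<le> \<mu> / (N + 1)"
  proof -
    \<comment> \<open>Negative correlation: the second factorial moment is at most the square of the mean.\<close>
    have "s * t * ((s - 1) * (t - 1)) / (N * (N - 1)) \<le> \<mu>\<^sup>2"
    proof (cases "s = 0 \<or> t = 0")
      case False
      then have "s \<ge> 1" "t \<ge> 1"
        using fin by (auto simp: s_def t_def Suc_le_eq card_gt_0_iff)
      have "s * t \<le> N * t"
        using st by (intro mult_right_mono) auto
      also have "\<dots> \<le> N * (s + t - 1)"
        using N \<open>s \<ge> 1\<close> by (intro mult_left_mono) auto
      finally have "N * ((s - 1) * (t - 1)) \<le> s * t * (N - 1)"
        by (simp add: algebra_simps)
      then have "((s - 1) * (t - 1)) / (N - 1) \<le> s * t / N"
        using N by (simp add: field_simps)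
      then have "(s * t / N) * (((s - 1) * (t - 1)) / (N - 1)) \<le> (s * t / N) * (s * t / N)"
        using st N by (intro mult_left_mono) auto
      then show ?thesis
        by (simp add: \<mu>' power2_eq_square)
    qed (auto simp: \<mu>')
    then show ?thesis
      using N by (intro divide_right_mono) auto
  qed
  finally have var: "?E (\<lambda>\<pi>. ?B \<pi> * (?C \<pi> - \<mu>)\<^sup>2) \<le> \<mu> / real n"
    using N by simp
  have "prob_perm n (\<lambda>\<pi>. \<pi> i = j \<and> x \<le> ?C \<pi>) \<le> ?E (\<lambda>\<pi>. ?B \<pi> * (?C \<pi> - \<mu>)\<^sup>2 / (x - \<mu>)\<^sup>2)"
    unfolding prob_perm_eq_expectation
  proof (intro integral_mono)
    fix \<pi> :: "nat \<Rightarrow> nat"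
    have "(x - \<mu>)\<^sup>2 \<le> (?C \<pi> - \<mu>)\<^sup>2" if "x \<le> ?C \<pi>"
      using that x by (intro power_mono) auto
    then show "of_bool (\<pi> i = j \<and> x \<le> ?C \<pi>) \<le> ?B \<pi> * (?C \<pi> - \<mu>)\<^sup>2 / (x - \<mu>)\<^sup>2"
      using x by auto
  qed simp_all
  also have "\<dots> = ?E (\<lambda>\<pi>. ?B \<pi> * (?C \<pi> - \<mu>)\<^sup>2) / (x - \<mu>)\<^sup>2"
    by simp
  also have "\<dots> \<le> (\<mu> / real n) / (x - \<mu>)\<^sup>2"
    by (intro divide_right_mono var) auto
  finally show ?thesis
    by simp
qed

section \<open>Degrees in the permutation graph\<close>

definition perm_degree :: "nat \<Rightarrow> (nat \<Rightarrow> nat) \<Rightarrow> nat \<Rightarrow> nat" where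
  "perm_degree n \<pi> i = out_degree (with_proj (permutation_graph n \<pi>)) i"

lemma perm_degree_eq_card:
  assumes "\<pi> permutes {1..n}" "i \<in> {1..n}"
  shows "perm_degree n \<pi> i = card {k \<in> {1..<i}. \<pi> i < \<pi> k} + card {k \<in> {i<..n}. \<pi> k < \<pi> i}"
proof -
  have "out_arcs (with_proj (permutation_graph n \<pi>)) i =
      Pair i ` ({k \<in> {1..<i}. \<pi> i < \<pi> k} \<union> {k \<in> {i<..n}. \<pi> k < \<pi> i})"
    using assms(2) by (auto simp: permutation_graph_def mult_less_0_iff)
  then have "perm_degree n \<pi> i = card ({k \<in> {1..<i}. \<pi> i < \<pi> k} \<union> {k \<in> {i<..n}. \<pi> k < \<pi> i})"
    by (simp add: perm_degree_def out_degree_def card_image inj_on_def)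
  also have "\<dots> = card {k \<in> {1..<i}. \<pi> i < \<pi> k} + card {k \<in> {i<..n}. \<pi> k < \<pi> i}"
    by (intro card_Un_disjoint) auto
  finally show ?thesis .
qed

lemma card_permutes_vimage:
  assumes "\<pi> permutes {1..n}" "B \<subseteq> {1..n}"
  shows "card {k \<in> {1..n}. \<pi> k \<in> B} = card B"
proof -
  have "{k \<in> {1..n}. \<pi> k \<in> B} = \<pi> -` B"
  proof (rule set_eqI)
    fix k show "k \<in> {k \<in> {1..n}. \<pi> k \<in> B} \<longleftrightarrow> k \<in> \<pi> -` B"
      using assms(2) permutes_not_in[OF assms(1), of k] by (cases "k \<in> {1..n}") auto
  qed
  then show ?thesis
    using card_vimage_inj[of \<pi> B] permutes_inj[OF assms(1)] permutes_surj[OF assms(1)] by simp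
qed

lemma card_filter_split:
  assumes "finite S" "\<And>k. k \<in> S \<Longrightarrow> P k \<longleftrightarrow> \<not> Q k"
  shows "card {k \<in> S. P k} + card {k \<in> S. Q k} = card S"
  using assms by (subst card_Un_disjoint[symmetric]) (auto intro!: arg_cong[where f = card])

text \<open>
  The neighbours of \<open>i\<close> are the earlier positions with larger values and the later positions with
  smaller values. The earlier positions that are not neighbours are those in the box below and to
  the left of the point \<open>(i, \<pi> i)\<close>; the same box contains the smaller values that are not
  attained by neighbours. So among \<open>i - 1\<close> positions and \<open>\<pi> i - 1\<close> values, the points of the
  box are left out twice.
\<close>

lemma perm_degree_lower_box:
  assumes \<pi>: "\<pi> permutes {1..n}" and i: "i \<in> {1..n}"
  shows "perm_degree n \<pi> i + 2 * card {k \<in> {1..<i}. \<pi> k \<in> {1..<\<pi> i}} = (i - 1) + (\<pi> i - 1)"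
proof -
  have \<pi>n: "\<pi> k \<in> {1..n}" if "k \<in> {1..n}" for k
    using permutes_in_image[OF \<pi>] that by blast
  have ne: "\<pi> k = \<pi> l \<longleftrightarrow> k = l" for k l
    using permutes_inj[OF \<pi>] by (auto dest: injD)
  have "card {k \<in> {1..<i}. \<pi> i < \<pi> k} + card {k \<in> {1..<i}. \<pi> k \<in> {1..<\<pi> i}} = card {1..<i}"
  proof (rule card_filter_split)
    fix k assume "k \<in> {1..<i}"
    then show "\<pi> i < \<pi> k \<longleftrightarrow> \<pi> k \<notin> {1..<\<pi> i}"
      using \<pi>n[of k] ne[of k i] i by auto
  qed simp
  moreover have "card {k \<in> {i<..n}. \<pi> k < \<pi> i} + card {k \<in> {1..<i}. \<pi> k \<in> {1..<\<pi> i}} =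
      card {k \<in> {1..n}. \<pi> k \<in> {1..<\<pi> i}}"
  proof (subst card_Un_disjoint[symmetric])
    have "{k \<in> {i<..n}. \<pi> k < \<pi> i} \<union> {k \<in> {1..<i}. \<pi> k \<in> {1..<\<pi> i}} =
        {k \<in> {1..n}. \<pi> k \<in> {1..<\<pi> i}}" (is "?A = ?B")
    proof (rule set_eqI)
      fix k show "k \<in> ?A \<longleftrightarrow> k \<in> ?B"
        using \<pi>n[of k] i by (cases k i rule: linorder_cases) auto
    qed
    then show "card ({k \<in> {i<..n}. \<pi> k < \<pi> i} \<union> {k \<in> {1..<i}. \<pi> k \<in> {1..<\<pi> i}}) =
        card {k \<in> {1..n}. \<pi> k \<in> {1..<\<pi> i}}"
      by simp
  qed auto
  moreover have "card {k \<in> {1..n}. \<pi> k \<in> {1..<\<pi> i}} = card {1..<\<pi> i}"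
    using \<pi>n[OF i] by (intro card_permutes_vimage[OF \<pi>]) auto
  ultimately show ?thesis
    unfolding perm_degree_eq_card[OF \<pi> i] by simp
qed

text \<open>
  The mirror image of the previous identity, seen from the corner \<open>(n, n)\<close>.
\<close>

lemma perm_degree_upper_box:
  assumes \<pi>: "\<pi> permutes {1..n}" and i: "i \<in> {1..n}"
  shows "perm_degree n \<pi> i + 2 * card {k \<in> {i<..n}. \<pi> k \<in> {\<pi> i<..n}} = (n - i) + (n - \<pi> i)"
proof -
  have \<pi>n: "\<pi> k \<in> {1..n}" if "k \<in> {1..n}" for k
    using permutes_in_image[OF \<pi>] that by blast
  have ne: "\<pi> k = \<pi> l \<longleftrightarrow> k = l" for k l
    using permutes_inj[OF \<pi>] by (auto dest: injD)
  have "card {k \<in> {i<..n}. \<pi> k < \<pi> i} + card {k \<in> {i<..n}. \<pi> k \<in> {\<pi> i<..n}} = card {i<..n}"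
  proof (rule card_filter_split)
    fix k assume "k \<in> {i<..n}"
    then show "\<pi> k < \<pi> i \<longleftrightarrow> \<pi> k \<notin> {\<pi> i<..n}"
      using \<pi>n[of k] ne[of k i] i by auto
  qed simp
  moreover have "card {k \<in> {1..<i}. \<pi> i < \<pi> k} + card {k \<in> {i<..n}. \<pi> k \<in> {\<pi> i<..n}} =
      card {k \<in> {1..n}. \<pi> k \<in> {\<pi> i<..n}}"
  proof (subst card_Un_disjoint[symmetric])
    have "{k \<in> {1..<i}. \<pi> i < \<pi> k} \<union> {k \<in> {i<..n}. \<pi> k \<in> {\<pi> i<..n}} =
        {k \<in> {1..n}. \<pi> k \<in> {\<pi> i<..n}}" (is "?A = ?B")
    proof (rule set_eqI)
      fix k show "k \<in> ?A \<longleftrightarrow> k \<in> ?B"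
        using \<pi>n[of k] i by (cases k i rule: linorder_cases) auto
    qed
    then show "card ({k \<in> {1..<i}. \<pi> i < \<pi> k} \<union> {k \<in> {i<..n}. \<pi> k \<in> {\<pi> i<..n}}) =
        card {k \<in> {1..n}. \<pi> k \<in> {\<pi> i<..n}}"
      by simp
  qed auto
  moreover have "card {k \<in> {1..n}. \<pi> k \<in> {\<pi> i<..n}} = card {\<pi> i<..n}"
    by (intro card_permutes_vimage[OF \<pi>]) auto
  ultimately show ?thesis
    unfolding perm_degree_eq_card[OF \<pi> i] by simp
qed

lemma perm_degree_ge_displacement:
  assumes \<pi>: "\<pi> permutes {1..n}" and i: "i \<in> {1..n}"
  shows "\<bar>real i - real (\<pi> i)\<bar> \<le> real (perm_degree n \<pi> i)"
proof -
  have range: "1 \<le> i" "i \<le> n" "1 \<le> \<pi> i" "\<pi> i \<le> n"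
    using permutes_in_image[OF \<pi>, of i] i by auto
  have "card {k \<in> {1..<i}. \<pi> k \<in> {1..<\<pi> i}} \<le> card {1..<i}"
    "card {k \<in> {i<..n}. \<pi> k \<in> {\<pi> i<..n}} \<le> card {i<..n}"
    by (intro card_mono; auto)+
  then have "\<pi> i \<le> i + perm_degree n \<pi> i" "i \<le> \<pi> i + perm_degree n \<pi> i"
    using perm_degree_lower_box[OF \<pi> i] perm_degree_upper_box[OF \<pi> i] range
    unfolding card_atLeastLessThan card_greaterThanAtMost by linarith+
  then show ?thesis
    by linarith
qed

lemma less_min_degree_iff:
  assumes "n \<ge> 1"
  shows "y < real (min_degree (with_proj (permutation_graph n \<pi>))) \<longleftrightarrow>
    (\<forall>i\<in>{1..n}. y < real (perm_degree n \<pi> i))"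
proof -
  have "verts (with_proj (permutation_graph n \<pi>)) = {1..n}"
    by (simp add: permutation_graph_def)
  then have "min_degree (with_proj (permutation_graph n \<pi>)) = Min (perm_degree n \<pi> ` {1..n})"
    by (simp add: min_degree_def perm_degree_def[abs_def])
  also have "real \<dots> = Min (real ` perm_degree n \<pi> ` {1..n})"
    using assms by (intro mono_Min_commute) (auto simp: mono_def)
  finally show ?thesis
    using assms by (simp add: Min_gr_iff)
qed

section \<open>The corner regions\<close>

text \<open>
  The cells within \<open>l1\<close>-distance \<open>y\<close> of one of the two corners \<open>(1, 1)\<close> and
  \<open>(n, n)\<close> of the board.
\<close>

definition corner_cells :: "nat \<Rightarrow> real \<Rightarrow> (nat \<times> nat) set" where
  "corner_cells n y = {(i, j). i \<in> {1..n} \<and> j \<in> {1..n} \<and>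
     (real ((i - 1) + (j - 1)) \<le> y \<or> real ((n - i) + (n - j)) \<le> y)}"

lemma real_le_iff_floor:
  assumes "y \<ge> 0"
  shows "real a \<le> y \<longleftrightarrow> a \<le> nat \<lfloor>y\<rfloor>"
  using assms by (simp add: le_nat_floor le_nat_iff le_floor_iff)

lemma card_triangle: "card {(a, b). a + b \<le> m} * 2 = (m + 1) * (m + 2)"
proof -
  have "{(a, b). a + b \<le> m} = (SIGMA a:{..m}. {..m - a})"
    by auto
  then have "card {(a, b). a + b \<le> m} = (\<Sum>a\<le>m. m - a + 1)"
    by simp
  also have "\<dots> = (\<Sum>a\<le>m. a + 1)"
    using sum.nat_diff_reindex[of "\<lambda>a. a + 1" "Suc m"] by (simp add: lessThan_Suc_atMost)
  also have "\<dots> * 2 = (m + 1) * (m + 2)"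
    by (induction m) auto
  finally show ?thesis .
qed

text \<open>
  Two disjoint triangles of \<open>(m + 1) (m + 2) / 2\<close> cells each.
\<close>

lemma card_corner_cells:
  assumes y: "y \<ge> 0" and m: "m = nat \<lfloor>y\<rfloor>" "m + 1 < n"
  shows "card (corner_cells n y) = (m + 1) * (m + 2)"
proof -
  let ?D = "{(a, b). a + b \<le> m}"
  let ?L = "(\<lambda>(a, b). (a + 1, b + 1)) ` ?D" and ?U = "(\<lambda>(a, b). (n - a, n - b)) ` ?D"
  have "?D \<subseteq> {..m} \<times> {..m}"
    by auto
  then have fin: "finite ?D"
    using finite_subset by blast
  have "corner_cells n y = ?L \<union> ?U"
  proof (intro set_eqI iffI)
    fix p assume "p \<in> corner_cells n y"
    then obtain i j where p: "p = (i, j)" "i \<in> {1..n}" "j \<in> {1..n}"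
        "(i - 1) + (j - 1) \<le> m \<or> (n - i) + (n - j) \<le> m"
      unfolding corner_cells_def real_le_iff_floor[OF y] m(1) by blast
    from p(4) show "p \<in> ?L \<union> ?U"
    proof
      assume "(i - 1) + (j - 1) \<le> m"
      then have "(i - 1, j - 1) \<in> ?D" by simp
      moreover have "p = (\<lambda>(a, b). (a + 1, b + 1)) (i - 1, j - 1)"
        using p by simp
      ultimately show ?thesis by blast
    next
      assume "(n - i) + (n - j) \<le> m"
      then have "(n - i, n - j) \<in> ?D" by simp
      moreover have "p = (\<lambda>(a, b). (n - a, n - b)) (n - i, n - j)"
        using p by simp
      ultimately show ?thesis by blast
    qed
  next
    fix p assume "p \<in> ?L \<union> ?U"
    then show "p \<in> corner_cells n y"
      unfolding corner_cells_def real_le_iff_floor[OF y] m(1)[symmetric] using m(2) by auto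
  qed
  moreover have "?L \<inter> ?U = {}"
    using m(2) by auto
  moreover have "card ?L = card ?D"
    by (intro card_image) (auto simp: inj_on_def)
  moreover have "card ?U = card ?D"
    using m(2) by (intro card_image) (auto simp: inj_on_def)
  ultimately have "card (corner_cells n y) = card ?D * 2"
    using fin by (simp add: card_Un_disjoint)
  then show ?thesis
    using card_triangle[of m] by simp
qed

lemma card_corner_line:
  assumes y: "y \<ge> 0"
  shows "card {p \<in> corner_cells n y. fst p = i} \<le> 2 * (nat \<lfloor>y\<rfloor> + 1)" (is "card ?R \<le> _")
    and "card {p \<in> corner_cells n y. snd p = i} \<le> 2 * (nat \<lfloor>y\<rfloor> + 1)" (is "card ?C \<le> _")
proof -
  define m where "m = nat \<lfloor>y\<rfloor>"
  let ?S = "{1..m + 1} \<union> {n - m..n}"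
  have "card ?S \<le> card {1..m + 1} + card {n - m..n}"
    by (rule card_Un_le)
  then have S: "card ?S \<le> 2 * (m + 1)"
    by simp
  have "?R \<subseteq> Pair i ` ?S"
    unfolding corner_cells_def real_le_iff_floor[OF y] m_def[symmetric] by auto
  then have "card ?R \<le> card (Pair i ` ?S)"
    by (intro card_mono) auto
  also have "\<dots> \<le> card ?S"
    by (intro card_image_le) auto
  finally show "card ?R \<le> 2 * (nat \<lfloor>y\<rfloor> + 1)"
    using S by (simp add: m_def)
  have "?C \<subseteq> (\<lambda>k. (k, i)) ` ?S"
    unfolding corner_cells_def real_le_iff_floor[OF y] m_def[symmetric] by auto
  then have "card ?C \<le> card ((\<lambda>k. (k, i)) ` ?S)"
    by (intro card_mono) auto
  also have "\<dots> \<le> card ?S"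
    by (intro card_image_le) auto
  finally show "card ?C \<le> 2 * (nat \<lfloor>y\<rfloor> + 1)"
    using S by (simp add: m_def)
qed

lemma real_nat_floor_bounds:
  assumes "y \<ge> 0"
  shows "real (nat \<lfloor>y\<rfloor>) \<le> y" "y \<le> real (nat \<lfloor>y\<rfloor>) + 1"
  using assms by linarith+

lemma prob_perm_avoid_corners:
  assumes \<gamma>: "\<gamma> \<ge> 0"
  shows "(\<lambda>n. prob_perm n (\<lambda>\<pi>. \<forall>(i, j)\<in>corner_cells n (\<gamma> * sqrt n). \<pi> i \<noteq> j))
           \<longlonglongrightarrow> exp (- \<gamma>\<^sup>2)"
proof (rule prob_perm_avoid_limit)
  let ?m = "\<lambda>n. nat \<lfloor>\<gamma> * sqrt (real n)\<rfloor>"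
  let ?w = "\<lambda>n. 2 * (?m n + 1)"
  have y: "\<gamma> * sqrt (real n) \<ge> 0" for n
    using \<gamma> by simp
  have inv_sqrt: "(\<lambda>n. 1 / sqrt (real n)) \<longlonglongrightarrow> 0"
    by real_asymp
  show "corner_cells n (\<gamma> * sqrt (real n)) \<subseteq> {1..n} \<times> {1..n}" for n
    by (auto simp: corner_cells_def)
  show "card {p \<in> corner_cells n (\<gamma> * sqrt (real n)). fst p = i} \<le> ?w n" for n i
    by (rule card_corner_line[OF y])
  show "card {p \<in> corner_cells n (\<gamma> * sqrt (real n)). snd p = j} \<le> ?w n" for n j
    by (rule card_corner_line[OF y])
  have up: "(\<lambda>n. 2 * \<gamma> * (1 / sqrt (real n)) + 2 * (1 / real n)) \<longlonglongrightarrow> 2 * \<gamma> * 0 + 2 * 0"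
    by (intro tendsto_intros inv_sqrt lim_1_over_n)
  show "(\<lambda>n. real (?w n) / real n) \<longlonglongrightarrow> 0"
  proof (rule tendsto_sandwich[OF _ _ tendsto_const])
    show "(\<lambda>n. 2 * \<gamma> * (1 / sqrt (real n)) + 2 * (1 / real n)) \<longlonglongrightarrow> 0"
      using up by simp
    show "\<forall>\<^sub>F n in sequentially. real (?w n) / real n \<le> 2 * \<gamma> * (1 / sqrt (real n)) + 2 * (1 / real n)"
      using eventually_gt_at_top[of 0]
    proof eventually_elim
      case (elim n)
      have "real (?w n) \<le> 2 * (\<gamma> * sqrt (real n) + 1)"
        using real_nat_floor_bounds(1)[OF y[of n]] by simp
      then have "real (?w n) / real n \<le> 2 * (\<gamma> * sqrt (real n) + 1) / real n"
        by (rule divide_right_mono) simp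
      also have "\<dots> = 2 * \<gamma> * (sqrt (real n) / real n) + 2 * (1 / real n)"
        by (simp add: add_divide_distrib)
      also have "sqrt (real n) / real n = 1 / sqrt (real n)"
        using elim by (simp add: field_simps)
      finally show ?case .
    qed
  qed simp
  have ev: "\<forall>\<^sub>F n in sequentially. \<gamma> * sqrt (real n) + 2 < real n"
    by real_asymp
  have up: "(\<lambda>n. (\<gamma> + 1 / sqrt (real n)) * (\<gamma> + 2 * (1 / sqrt (real n)))) \<longlonglongrightarrow> (\<gamma> + 0) * (\<gamma> + 2 * 0)"
    by (intro tendsto_intros inv_sqrt)
  show "(\<lambda>n. real (card (corner_cells n (\<gamma> * sqrt (real n)))) / real n) \<longlonglongrightarrow> \<gamma>\<^sup>2"
  proof (rule tendsto_sandwich[OF _ _ tendsto_const])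
    show "(\<lambda>n. (\<gamma> + 1 / sqrt (real n)) * (\<gamma> + 2 * (1 / sqrt (real n)))) \<longlonglongrightarrow> \<gamma>\<^sup>2"
      using up by (simp add: power2_eq_square)
    have card: "real (card (corner_cells n (\<gamma> * sqrt (real n)))) = (real (?m n) + 1) * (real (?m n) + 2)"
      if "\<gamma> * sqrt (real n) + 2 < real n" for n
    proof -
      have "?m n + 1 < n"
        using real_nat_floor_bounds(1)[OF y[of n]] that by linarith
      then show ?thesis
        by (subst card_corner_cells[OF y refl]) (simp_all add: algebra_simps)
    qed
    show "\<forall>\<^sub>F n in sequentially. \<gamma>\<^sup>2 \<le> real (card (corner_cells n (\<gamma> * sqrt (real n)))) / real n"
      using ev eventually_gt_at_top[of 0]
    proof eventually_elim
      case (elim n)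
      have "(\<gamma> * sqrt (real n)) * (\<gamma> * sqrt (real n)) \<le> (real (?m n) + 1) * (real (?m n) + 2)"
        by (intro mult_mono; use real_nat_floor_bounds[OF y[of n]] y[of n] in linarith)
      then have "\<gamma>\<^sup>2 * real n \<le> (real (?m n) + 1) * (real (?m n) + 2)"
        by (simp add: power2_eq_square mult_ac)
      then show ?case
        using elim by (simp add: card pos_le_divide_eq)
    qed
    show "\<forall>\<^sub>F n in sequentially. real (card (corner_cells n (\<gamma> * sqrt (real n)))) / real n
        \<le> (\<gamma> + 1 / sqrt (real n)) * (\<gamma> + 2 * (1 / sqrt (real n)))"
      using ev eventually_gt_at_top[of 0]
    proof eventually_elim
      case (elim n)
      have "(real (?m n) + 1) * (real (?m n) + 2) \<le> (\<gamma> * sqrt (real n) + 1) * (\<gamma> * sqrt (real n) + 2)"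
        by (intro mult_mono; use real_nat_floor_bounds[OF y[of n]] y[of n] in linarith)
      then have "(real (?m n) + 1) * (real (?m n) + 2) / real n
          \<le> (\<gamma> * sqrt (real n) + 1) * (\<gamma> * sqrt (real n) + 2) / real n"
        by (rule divide_right_mono) simp
      also have "\<dots> = ((\<gamma> * sqrt (real n) + 1) / sqrt (real n)) * ((\<gamma> * sqrt (real n) + 2) / sqrt (real n))"
        by simp
      also have "\<dots> = (\<gamma> + 1 / sqrt (real n)) * (\<gamma> + 2 * (1 / sqrt (real n)))"
        using elim by (simp add: add_divide_distrib)
      finally show ?case
        using elim by (simp add: card)
    qed
  qed
qed

section \<open>No low degrees away from the corners\<close>

text \<open>
  Away from the corners, a low degree requires a box with too many points. By the degree identities,
  degree at most \<open>y\<close> forces at least \<open>(u - y) / 2\<close> points in a box of half-perimeter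
  \<open>u = \<bar>R\<bar> + \<bar>L\<bar>\<close>, whereas the expected number is at most \<open>u\<^sup>2 / (4 (n - 1))\<close>. The
  excess is at least \<open>c u\<close>: for small boxes because the mean is a small fraction of \<open>u\<close> while
  \<open>y\<close> is at most \<open>q u\<close>; for large boxes because \<open>y\<close> is negligible and \<open>u \<le> n - 1\<close> keeps
  the mean below \<open>u / 4\<close>, half of the required \<open>u / 2\<close>. As the variance is of order
  \<open>u\<^sup>2 / n\<close>, Chebyshev's inequality gives a bound in which \<open>u\<close> cancels.
\<close>

lemma prob_box_count_large:
  fixes y y' q u c :: real
  assumes n: "n \<ge> 3" and ij: "i \<in> {1..n}" "j \<in> {1..n}"
    and R: "R \<subseteq> {1..n} - {i}" and L: "L \<subseteq> {1..n} - {j}"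
    and u: "u = real (card R + card L)" "u \<le> real n - 1" "y' < u"
    and q: "0 \<le> q" "q < 1" "y = q * y'" "y' \<ge> 0" "y \<le> (1 - q) * (real n - 1) / 4"
    and c: "c = min (1/8) ((1 - q) / 4)"
  shows "prob_perm n (\<lambda>\<pi>. \<pi> i = j \<and> (u - y) / 2 \<le> real (card {k \<in> R. \<pi> k \<in> L}))
    \<le> 1 / (4 * c\<^sup>2 * (real n * (real n - 1)))"
proof -
  define N where "N = real n - 1"
  have N: "N \<ge> 2" using n by (simp add: N_def)
  define \<mu> where "\<mu> = real (card R) * real (card L) / N"
  have u0: "u > 0" using u(3) q(4) by simp
  have c0: "c > 0" using q c by simp
  have c_le: "c \<le> 1 / 8" "c \<le> (1 - q) / 4"
    unfolding c by (rule min.cobounded1, rule min.cobounded2)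
  \<comment> \<open>The inequality of arithmetic and geometric means.\<close>
  have "4 * (real (card R) * real (card L)) \<le> u\<^sup>2"
    using zero_le_power2[of "real (card R) - real (card L)"]
    by (simp add: u(1) power2_eq_square algebra_simps)
  then have \<mu>: "\<mu> \<le> u\<^sup>2 / (4 * N)"
    using N by (simp add: \<mu>_def field_simps)
  have \<mu>u: "\<mu> \<le> u * (u / (4 * N))"
    using \<mu> by (simp add: power2_eq_square)
  have dev: "c * u \<le> (u - y) / 2 - \<mu>"
  proof (cases "u \<le> (1 - q) * N")
    case True
    have "y \<le> q * u"
      using q u by (simp add: mult_left_mono)
    moreover have "u * (u / (4 * N)) \<le> u * ((1 - q) / 4)"
      using True u0 N by (intro mult_left_mono) (auto simp: field_simps)
    moreover have "c * u \<le> (1 - q) / 4 * u"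
      using u0 by (intro mult_right_mono c_le) simp
    ultimately have "\<mu> \<le> u / 4 - q * u / 4" "c * u \<le> u / 4 - q * u / 4"
      using \<mu>u by (simp_all add: algebra_simps)
    then show ?thesis
      using \<open>y \<le> q * u\<close> by (simp add: field_simps)
  next
    case False
    then have "y \<le> u / 4"
      using q(5) by (simp add: N_def)
    moreover have "u * (u / (4 * N)) \<le> u * (1 / 4)"
      using u(2) u0 N by (intro mult_left_mono) (auto simp: field_simps N_def)
    moreover have "c * u \<le> 1 / 8 * u"
      using u0 by (intro mult_right_mono c_le) simp
    ultimately show ?thesis
      using \<mu>u by (simp add: field_simps)
  qed
  have cu: "c * u > 0" using c0 u0 by simp
  with dev have less: "\<mu> < (u - y) / 2" by linarith
  have "prob_perm n (\<lambda>\<pi>. \<pi> i = j \<and> (u - y) / 2 \<le> real (card {k \<in> R. \<pi> k \<in> L}))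
      \<le> \<mu> / (real n * ((u - y) / 2 - \<mu>)\<^sup>2)"
    by (intro chebyshev_box_count n ij R L less) (simp add: \<mu>_def N_def)
  also have "\<dots> \<le> (u\<^sup>2 / (4 * N)) / (real n * (c * u)\<^sup>2)"
    using \<mu> dev cu n N u0 c0 by (intro frac_le mult_left_mono power_mono mult_pos_pos zero_less_power) auto
  also have "\<dots> = 1 / (4 * c\<^sup>2 * (real n * N))"
    using u0 c0 N n by (simp add: field_simps power2_eq_square)
  finally show ?thesis
    by (simp add: N_def)
qed

text \<open>
  The box below and to the left of \<open>(i, j)\<close> serves if the cell lies in the half of the board
  nearer to \<open>(1, 1)\<close>, the box above and to the right otherwise. This choice keeps the
  half-perimeter of the box at most \<open>n - 1\<close>.
\<close>

lemma prob_low_degree_cell: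
  fixes y y' q c :: real
  assumes n: "n \<ge> 3" and ij: "i \<in> {1..n}" "j \<in> {1..n}" "(i, j) \<notin> corner_cells n y'"
    and q: "0 \<le> q" "q < 1" "y = q * y'" "y' \<ge> 0" "y \<le> (1 - q) * (real n - 1) / 4"
    and c: "c = min (1/8) ((1 - q) / 4)"
  shows "prob_perm n (\<lambda>\<pi>. \<pi> i = j \<and> real (perm_degree n \<pi> i) \<le> y)
    \<le> 1 / (4 * c\<^sup>2 * (real n * (real n - 1)))"
proof (cases "i + j \<le> n + 1")
  case True
  let ?u = "real ((i - 1) + (j - 1))"
  have "prob_perm n (\<lambda>\<pi>. \<pi> i = j \<and> real (perm_degree n \<pi> i) \<le> y) \<le>
      prob_perm n (\<lambda>\<pi>. \<pi> i = j \<and> (?u - y) / 2 \<le> real (card {k \<in> {1..<i}. \<pi> k \<in> {1..<j}}))"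
  proof (rule prob_perm_mono)
    fix \<pi> assume \<pi>: "\<pi> permutes {1..n}" and *: "\<pi> i = j \<and> real (perm_degree n \<pi> i) \<le> y"
    then have "real (perm_degree n \<pi> i) + 2 * real (card {k \<in> {1..<i}. \<pi> k \<in> {1..<j}}) = ?u"
      using perm_degree_lower_box[OF \<pi> ij(1)] by (metis of_nat_add of_nat_mult of_nat_numeral)
    with * show "\<pi> i = j \<and> (?u - y) / 2 \<le> real (card {k \<in> {1..<i}. \<pi> k \<in> {1..<j}})"
      by simp
  qed
  also have "\<dots> \<le> 1 / (4 * c\<^sup>2 * (real n * (real n - 1)))"
  proof (rule prob_box_count_large[OF n ij(1,2) _ _ _ _ _ q c])
    show "?u \<le> real n - 1"
      using True ij by simp
    show "y' < ?u"
      using ij unfolding corner_cells_def by auto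
  qed (use ij in auto)
  finally show ?thesis .
next
  case False
  let ?u = "real ((n - i) + (n - j))"
  have "prob_perm n (\<lambda>\<pi>. \<pi> i = j \<and> real (perm_degree n \<pi> i) \<le> y) \<le>
      prob_perm n (\<lambda>\<pi>. \<pi> i = j \<and> (?u - y) / 2 \<le> real (card {k \<in> {i<..n}. \<pi> k \<in> {j<..n}}))"
  proof (rule prob_perm_mono)
    fix \<pi> assume \<pi>: "\<pi> permutes {1..n}" and *: "\<pi> i = j \<and> real (perm_degree n \<pi> i) \<le> y"
    then have "real (perm_degree n \<pi> i) + 2 * real (card {k \<in> {i<..n}. \<pi> k \<in> {j<..n}}) = ?u"
      using perm_degree_upper_box[OF \<pi> ij(1)] by (metis of_nat_add of_nat_mult of_nat_numeral)
    with * show "\<pi> i = j \<and> (?u - y) / 2 \<le> real (card {k \<in> {i<..n}. \<pi> k \<in> {j<..n}})"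
      by simp
  qed
  also have "\<dots> \<le> 1 / (4 * c\<^sup>2 * (real n * (real n - 1)))"
  proof (rule prob_box_count_large[OF n ij(1,2) _ _ _ _ _ q c])
    have "(n - i) + (n - j) \<le> n - 1"
      using False ij by auto
    then have "?u \<le> real (n - 1)"
      by (rule of_nat_mono)
    then show "?u \<le> real n - 1"
      using n by simp
    show "y' < ?u"
      using ij unfolding corner_cells_def by auto
  qed (use ij in auto)
  finally show ?thesis .
qed

lemma card_strip:
  assumes "y \<ge> 0"
  shows "real (card {(i, j). i \<in> {1..n} \<and> j \<in> {1..n} \<and> \<bar>real i - real j\<bar> \<le> y}) \<le> real n * (2 * y + 1)"
proof -
  define m where "m = nat \<lfloor>y\<rfloor>"
  have "{(i, j). i \<in> {1..n} \<and> j \<in> {1..n} \<and> \<bar>real i - real j\<bar> \<le> y} \<subseteq> (SIGMA i:{1..n}. {i - m..i + m})"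
  proof
    fix p assume "p \<in> {(i, j). i \<in> {1..n} \<and> j \<in> {1..n} \<and> \<bar>real i - real j\<bar> \<le> y}"
    then obtain i j where *: "p = (i, j)" "i \<in> {1..n}" "\<bar>real i - real j\<bar> \<le> y"
      by auto
    then have "real (i - j) \<le> y" "real (j - i) \<le> y"
      by linarith+
    then have "i - j \<le> m" "j - i \<le> m"
      unfolding real_le_iff_floor[OF assms] m_def .
    with * show "p \<in> (SIGMA i:{1..n}. {i - m..i + m})"
      by auto
  qed
  then have "card {(i, j). i \<in> {1..n} \<and> j \<in> {1..n} \<and> \<bar>real i - real j\<bar> \<le> y}
      \<le> card (SIGMA i:{1..n}. {i - m..i + m})"
    by (intro card_mono) auto
  also have "\<dots> = (\<Sum>i\<in>{1..n}. card {i - m..i + m})"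
    by (intro card_SigmaI) auto
  also have "\<dots> \<le> (\<Sum>i\<in>{1..n}. 2 * m + 1)"
    by (intro sum_mono) auto
  finally have "real (card {(i, j). i \<in> {1..n} \<and> j \<in> {1..n} \<and> \<bar>real i - real j\<bar> \<le> y})
      \<le> real (n * (2 * m + 1))"
    by (intro of_nat_mono) simp
  also have "\<dots> \<le> real n * (2 * y + 1)"
    unfolding of_nat_mult using real_nat_floor_bounds(1)[OF assms]
    by (intro mult_left_mono) (auto simp: m_def)
  finally show ?thesis .
qed

text \<open>
  A point of degree at most \<open>\<gamma> sqrt n\<close> lies within \<open>\<gamma> sqrt n\<close> of the diagonal, which leaves
  \<open>O(n sqrt n)\<close> cells. Each of them, if outside the corners, carries a point of low degree with
  probability \<open>O(1 / n\<^sup>2)\<close>, so the union bound is of order \<open>1 / sqrt n\<close>. The strict inequality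
  \<open>\<gamma> < \<gamma>'\<close> is essential: it is what makes the required number of points in a small box
  grow with \<open>n\<close>.
\<close>

lemma prob_low_degree_off_corner:
  assumes \<gamma>: "0 \<le> \<gamma>" "\<gamma> < \<gamma>'"
  shows "(\<lambda>n. prob_perm n (\<lambda>\<pi>. \<exists>i\<in>{1..n}. real (perm_degree n \<pi> i) \<le> \<gamma> * sqrt n \<and>
            (i, \<pi> i) \<notin> corner_cells n (\<gamma>' * sqrt n))) \<longlonglongrightarrow> 0"
proof -
  define q where "q = \<gamma> / \<gamma>'"
  have q: "0 \<le> q" "q < 1" "\<gamma> = q * \<gamma>'"
    using \<gamma> by (auto simp: q_def)
  define c where "c = min (1/8) ((1 - q) / 4)"
  have c0: "c > 0"
    using q by (simp add: c_def)
  define K where "K = 1 / (4 * c\<^sup>2)"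
  have K0: "K > 0"
    using c0 by (simp add: K_def)
  have ev: "\<forall>\<^sub>F n in sequentially. \<gamma> * sqrt (real n) \<le> (1 - q) / 4 * (real n - 1)"
    using q(2) by real_asymp
  have bound: "prob_perm n (\<lambda>\<pi>. \<exists>i\<in>{1..n}. real (perm_degree n \<pi> i) \<le> \<gamma> * sqrt n \<and>
      (i, \<pi> i) \<notin> corner_cells n (\<gamma>' * sqrt n)) \<le> (2 * (\<gamma> * sqrt n) + 1) * K / (real n - 1)"
    if n: "n \<ge> 3" "\<gamma> * sqrt (real n) \<le> (1 - q) / 4 * (real n - 1)" for n
  proof -
    let ?y = "\<gamma> * sqrt (real n)" and ?y' = "\<gamma>' * sqrt (real n)"
    define S where "S = {(i, j). i \<in> {1..n} \<and> j \<in> {1..n} \<and> \<bar>real i - real j\<bar> \<le> ?y}"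
    define S' where "S' = S - corner_cells n ?y'"
    have "S \<subseteq> {1..n} \<times> {1..n}"
      by (auto simp: S_def)
    then have "finite S"
      by (rule finite_subset) simp
    then have finS: "finite S" "finite S'"
      by (simp_all add: S'_def)
    have "prob_perm n (\<lambda>\<pi>. \<exists>i\<in>{1..n}. real (perm_degree n \<pi> i) \<le> ?y \<and> (i, \<pi> i) \<notin> corner_cells n ?y')
        \<le> prob_perm n (\<lambda>\<pi>. \<exists>p\<in>S'. \<pi> (fst p) = snd p \<and> real (perm_degree n \<pi> (fst p)) \<le> ?y)"
    proof (rule prob_perm_mono)
      fix \<pi> assume \<pi>: "\<pi> permutes {1..n}"
        and "\<exists>i\<in>{1..n}. real (perm_degree n \<pi> i) \<le> ?y \<and> (i, \<pi> i) \<notin> corner_cells n ?y'"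
      then obtain i where i: "i \<in> {1..n}" "real (perm_degree n \<pi> i) \<le> ?y"
          "(i, \<pi> i) \<notin> corner_cells n ?y'"
        by blast
      have "\<bar>real i - real (\<pi> i)\<bar> \<le> ?y"
        using perm_degree_ge_displacement[OF \<pi> i(1)] i(2) by linarith
      then have "(i, \<pi> i) \<in> S'"
        using i permutes_in_image[OF \<pi>, of i] by (auto simp: S'_def S_def)
      with i show "\<exists>p\<in>S'. \<pi> (fst p) = snd p \<and> real (perm_degree n \<pi> (fst p)) \<le> ?y"
        by force
    qed
    also have "{\<pi>. \<exists>p\<in>S'. \<pi> (fst p) = snd p \<and> real (perm_degree n \<pi> (fst p)) \<le> ?y} =
        (\<Union>p\<in>S'. {\<pi>. \<pi> (fst p) = snd p \<and> real (perm_degree n \<pi> (fst p)) \<le> ?y})"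
      by auto
    also have "measure_pmf.prob (uniform_permutation n) \<dots> \<le>
        (\<Sum>p\<in>S'. prob_perm n (\<lambda>\<pi>. \<pi> (fst p) = snd p \<and> real (perm_degree n \<pi> (fst p)) \<le> ?y))"
      using finS by (intro measure_pmf.finite_measure_subadditive_finite) auto
    also have "\<dots> \<le> (\<Sum>p\<in>S'. K / (real n * (real n - 1)))"
    proof (rule sum_mono)
      fix p assume p: "p \<in> S'"
      have "prob_perm n (\<lambda>\<pi>. \<pi> (fst p) = snd p \<and> real (perm_degree n \<pi> (fst p)) \<le> ?y)
          \<le> 1 / (4 * c\<^sup>2 * (real n * (real n - 1)))"
      proof (rule prob_low_degree_cell[OF n(1) _ _ _ q(1,2) _ _ _ c_def])
        show "?y = q * ?y'"
          using q(3) by simp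
        show "?y \<le> (1 - q) * (real n - 1) / 4"
          using n(2) by simp
      qed (use p \<gamma> in \<open>auto simp: S'_def S_def\<close>)
      then show "prob_perm n (\<lambda>\<pi>. \<pi> (fst p) = snd p \<and> real (perm_degree n \<pi> (fst p)) \<le> ?y)
          \<le> K / (real n * (real n - 1))"
        by (simp add: K_def)
    qed
    also have "\<dots> = real (card S') * (K / (real n * (real n - 1)))"
      by simp
    also have "\<dots> \<le> (real n * (2 * ?y + 1)) * (K / (real n * (real n - 1)))"
    proof (rule mult_right_mono)
      have "card S' \<le> card S"
        using finS by (intro card_mono) (auto simp: S'_def)
      then show "real (card S') \<le> real n * (2 * ?y + 1)"
        using card_strip[of ?y n] \<gamma> by (simp add: S_def)
      show "0 \<le> K / (real n * (real n - 1))"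
        using K0 n by simp
    qed
    also have "\<dots> = (2 * ?y + 1) * K / (real n - 1)"
      using n by simp
    finally show ?thesis .
  qed
  have "(\<lambda>n. (2 * (\<gamma> * sqrt (real n)) + 1) * K / (real n - 1)) \<longlonglongrightarrow> 0"
    by real_asymp
  then show ?thesis
  proof (rule tendsto_sandwich[OF _ _ tendsto_const, rotated 2])
    show "\<forall>\<^sub>F n in sequentially. prob_perm n (\<lambda>\<pi>. \<exists>i\<in>{1..n}. real (perm_degree n \<pi> i) \<le> \<gamma> * sqrt n \<and>
      (i, \<pi> i) \<notin> corner_cells n (\<gamma>' * sqrt n)) \<le> (2 * (\<gamma> * sqrt n) + 1) * K / (real n - 1)"
      using ev eventually_ge_at_top[of 3] by eventually_elim (rule bound)
  qed simp
qed

section \<open>The limit law of the minimum degree\<close>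

text \<open>
  A point in the corner regions for \<open>\<gamma>\<close> has degree at most \<open>\<gamma> sqrt n\<close>, which gives the
  upper bound. Conversely, if the slightly larger regions for \<open>\<gamma>' > \<gamma>\<close> are empty and no point
  off these regions has low degree, then the minimum degree exceeds \<open>\<gamma> sqrt n\<close>. Letting
  \<open>\<gamma>'\<close> decrease to \<open>\<gamma>\<close> closes the gap, because the limit is continuous in \<open>\<gamma>\<close>.
\<close>

theorem prob_min_degree_limit:
  assumes \<gamma>: "\<gamma> \<ge> 0"
  shows "(\<lambda>n. prob_perm n (\<lambda>\<pi>. \<gamma> * sqrt n < real (min_degree (with_proj (permutation_graph n \<pi>)))))
           \<longlonglongrightarrow> exp (- \<gamma>\<^sup>2)"
proof (rule order_tendstoI)
  let ?P = "\<lambda>n. prob_perm n (\<lambda>\<pi>. \<gamma> * sqrt n < real (min_degree (with_proj (permutation_graph n \<pi>))))"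
  let ?A = "\<lambda>\<gamma> n. prob_perm n (\<lambda>\<pi>. \<forall>(i, j)\<in>corner_cells n (\<gamma> * sqrt n). \<pi> i \<noteq> j)"
  let ?B = "\<lambda>\<gamma>' n. prob_perm n (\<lambda>\<pi>. \<exists>i\<in>{1..n}. real (perm_degree n \<pi> i) \<le> \<gamma> * sqrt n \<and>
            (i, \<pi> i) \<notin> corner_cells n (\<gamma>' * sqrt n))"
  {
    fix a assume "exp (- \<gamma>\<^sup>2) < a"
    then have "\<forall>\<^sub>F n in sequentially. ?A \<gamma> n < a"
      using order_tendstoD(2)[OF prob_perm_avoid_corners[OF \<gamma>]] by blast
    then show "\<forall>\<^sub>F n in sequentially. ?P n < a"
      using eventually_ge_at_top[of 1]
    proof eventually_elim
      case (elim n)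
      have "?P n \<le> ?A \<gamma> n"
      proof (rule prob_perm_mono, clarify)
        fix \<pi> i
        assume \<pi>: "\<pi> permutes {1..n}" and c: "(i, \<pi> i) \<in> corner_cells n (\<gamma> * sqrt n)"
          and "\<gamma> * sqrt n < real (min_degree (with_proj (permutation_graph n \<pi>)))"
        then have d: "\<gamma> * sqrt n < real (perm_degree n \<pi> i)" and i: "i \<in> {1..n}"
          using less_min_degree_iff[OF elim(2)] by (auto simp: corner_cells_def)
        have "perm_degree n \<pi> i \<le> (i - 1) + (\<pi> i - 1)" "perm_degree n \<pi> i \<le> (n - i) + (n - \<pi> i)"
          using perm_degree_lower_box[OF \<pi> i] perm_degree_upper_box[OF \<pi> i] by linarith+
        then have "real (perm_degree n \<pi> i) \<le> real ((i - 1) + (\<pi> i - 1))"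
          "real (perm_degree n \<pi> i) \<le> real ((n - i) + (n - \<pi> i))"
          by (simp_all only: of_nat_le_iff)
        with c d show False
          unfolding corner_cells_def by auto
      qed
      with elim show ?case by simp
    qed
  }
  {
    fix a assume "a < exp (- \<gamma>\<^sup>2)"
    moreover have "((\<lambda>x. exp (- x\<^sup>2)) \<longlongrightarrow> exp (- \<gamma>\<^sup>2)) (at_right \<gamma>)"
      by (intro tendsto_intros)
    ultimately have "\<forall>\<^sub>F x in at_right \<gamma>. a < exp (- x\<^sup>2)"
      by (rule order_tendstoD(1)[rotated])
    moreover have "\<forall>\<^sub>F x in at_right \<gamma>. \<gamma> < x"
      by (rule eventually_at_right_less)
    ultimately have "\<forall>\<^sub>F x in at_right \<gamma>. a < exp (- x\<^sup>2) \<and> \<gamma> < x"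
      by (rule eventually_conj)
    then obtain \<gamma>' where \<gamma>': "a < exp (- \<gamma>'\<^sup>2)" "\<gamma> < \<gamma>'"
      using eventually_happens'[OF trivial_limit_at_right_real] by blast
    have "(\<lambda>n. ?A \<gamma>' n - ?B \<gamma>' n) \<longlonglongrightarrow> exp (- \<gamma>'\<^sup>2) - 0"
      using \<gamma> \<gamma>' by (intro tendsto_diff prob_perm_avoid_corners prob_low_degree_off_corner) auto
    then have "\<forall>\<^sub>F n in sequentially. a < ?A \<gamma>' n - ?B \<gamma>' n"
      using order_tendstoD(1) \<gamma>' by fastforce
    then show "\<forall>\<^sub>F n in sequentially. a < ?P n"
      using eventually_ge_at_top[of 1]
    proof eventually_elim
      case (elim n)
      let ?E = "{\<pi>. \<gamma> * sqrt n < real (min_degree (with_proj (permutation_graph n \<pi>)))}"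
      let ?F = "{\<pi>. \<exists>i\<in>{1..n}. real (perm_degree n \<pi> i) \<le> \<gamma> * sqrt n \<and>
            (i, \<pi> i) \<notin> corner_cells n (\<gamma>' * sqrt n)}"
      have "?A \<gamma>' n \<le> measure_pmf.prob (uniform_permutation n) (?E \<union> ?F)"
      proof (rule measure_pmf.finite_measure_mono)
        show "{\<pi>. \<forall>(i, j)\<in>corner_cells n (\<gamma>' * sqrt n). \<pi> i \<noteq> j} \<subseteq> ?E \<union> ?F"
        proof
          fix \<pi> assume "\<pi> \<in> {\<pi>. \<forall>(i, j)\<in>corner_cells n (\<gamma>' * sqrt n). \<pi> i \<noteq> j}"
          then have *: "(i, \<pi> i) \<notin> corner_cells n (\<gamma>' * sqrt n)" for i
            by auto
          show "\<pi> \<in> ?E \<union> ?F"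
          proof (cases "\<forall>i\<in>{1..n}. \<gamma> * sqrt n < real (perm_degree n \<pi> i)")
            case True
            then show ?thesis
              using less_min_degree_iff[OF elim(2)] by blast
          next
            case False
            then show ?thesis
              using * by (auto simp: not_less)
          qed
        qed
      qed simp
      also have "\<dots> \<le> ?P n + ?B \<gamma>' n"
        by (rule measure_Un_le) auto
      finally show ?case
        using elim(1) by linarith
    qed
  }
qed

section \<open>The Rayleigh distribution and weak convergence\<close>

lemma rayleigh_density_half: "rayleigh_density (1 / sqrt 2) x = (if x < 0 then 0 else 2 * x * exp (- x\<^sup>2))"
  by (simp add: rayleigh_density_def power_divide)

lemma borel_measurable_rayleigh_density_half:
  "rayleigh_density (1 / sqrt 2) \<in> borel_measurable borel"
  unfolding rayleigh_density_half[abs_def] by measurable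

lemma emeasure_rayleigh_atLeast:
  assumes "a \<ge> 0"
  shows "emeasure (rayleigh_distribution (1 / sqrt 2)) {a..} = ennreal (exp (- a\<^sup>2))"
proof -
  let ?f = "\<lambda>x::real. 2 * x * exp (- x\<^sup>2)"
  have "emeasure (rayleigh_distribution (1 / sqrt 2)) {a..} =
      (\<integral>\<^sup>+x. ennreal (rayleigh_density (1 / sqrt 2) x) * indicator {a..} x \<partial>lborel)"
    unfolding rayleigh_distribution_def using borel_measurable_rayleigh_density_half by (subst emeasure_density) auto
  also have "\<dots> = (\<integral>\<^sup>+x. ennreal (?f x) * indicator {a..} x \<partial>lborel)"
    using assms by (intro nn_integral_cong) (auto simp: rayleigh_density_half indicator_def)
  also have "\<dots> = ennreal (0 - (- exp (- a\<^sup>2)))"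
  proof (rule nn_integral_FTC_atLeast)
    show "((\<lambda>x::real. - exp (- x\<^sup>2)) has_real_derivative ?f x) (at x)" for x
      by (auto intro!: derivative_eq_intros)
    show "((\<lambda>x::real. - exp (- x\<^sup>2)) \<longlongrightarrow> 0) at_top"
      by real_asymp
  qed (use assms in auto)
  finally show ?thesis
    by simp
qed

lemma prob_space_rayleigh: "prob_space (rayleigh_distribution (1 / sqrt 2))"
proof
  have "emeasure (rayleigh_distribution (1 / sqrt 2)) (space (rayleigh_distribution (1 / sqrt 2))) =
      (\<integral>\<^sup>+x. ennreal (rayleigh_density (1 / sqrt 2) x) * indicator UNIV x \<partial>lborel)"
    unfolding rayleigh_distribution_def using borel_measurable_rayleigh_density_half by (subst emeasure_density) auto
  also have "\<dots> = (\<integral>\<^sup>+x. ennreal (rayleigh_density (1 / sqrt 2) x) * indicator {0..} x \<partial>lborel)"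
    by (intro nn_integral_cong) (auto simp: rayleigh_density_half indicator_def)
  also have "\<dots> = emeasure (rayleigh_distribution (1 / sqrt 2)) {0..}"
    unfolding rayleigh_distribution_def using borel_measurable_rayleigh_density_half by (subst emeasure_density) auto
  finally show "emeasure (rayleigh_distribution (1 / sqrt 2))
      (space (rayleigh_distribution (1 / sqrt 2))) = 1"
    by (simp add: emeasure_rayleigh_atLeast)
qed

lemma measure_rayleigh_greaterThan:
  assumes "a \<ge> 0"
  shows "measure (rayleigh_distribution (1 / sqrt 2)) {a<..} = exp (- a\<^sup>2)"
proof -
  let ?M = "rayleigh_distribution (1 / sqrt 2)"
  have "absolutely_continuous lborel ?M"
    unfolding rayleigh_distribution_def using borel_measurable_rayleigh_density_half by (intro absolutely_continuousI_density) auto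
  moreover have "{a} \<in> null_sets lborel"
    by (intro null_setsI) auto
  ultimately have "{a} \<in> null_sets ?M"
    unfolding absolutely_continuous_def by (rule subsetD)
  then have "emeasure ?M {a<..} = emeasure ?M ({a<..} \<union> {a})"
    by (intro emeasure_Un_null_set[symmetric]) (auto simp: rayleigh_distribution_def)
  also have "{a<..} \<union> {a} = {a..}"
    by auto
  finally show ?thesis
    by (simp add: emeasure_rayleigh_atLeast[OF assms] measure_def)
qed

lemma cdf_rayleigh:
  "cdf (rayleigh_distribution (1 / sqrt 2)) x = (if x < 0 then 0 else 1 - exp (- x\<^sup>2))"
proof -
  let ?M = "rayleigh_distribution (1 / sqrt 2)"
  interpret M: prob_space ?M
    by (rule prob_space_rayleigh)
  have sp: "space ?M = UNIV" "sets ?M = sets borel"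
    by (simp_all add: rayleigh_distribution_def)
  have nonneg: "cdf ?M x = 1 - exp (- x\<^sup>2)" if "x \<ge> 0" for x
  proof -
    have "{..x} = space ?M - {x<..}"
      by (auto simp: sp)
    then have "cdf ?M x = 1 - M.prob {x<..}"
      unfolding cdf_def by (simp only:) (rule M.prob_compl, simp add: sp)
    then show ?thesis
      by (simp add: measure_rayleigh_greaterThan[OF that])
  qed
  have "cdf ?M x = 0" if "x < 0"
  proof -
    have "cdf ?M x \<le> cdf ?M 0"
      unfolding cdf_def using that by (intro M.finite_measure_mono) (auto simp: sp)
    also have "\<dots> = 0"
      by (simp add: nonneg)
    finally show ?thesis
      by (simp add: cdf_def measure_le_0_iff)
  qed
  with nonneg show ?thesis
    by simp
qed

theorem theorem3p7:
  shows "weak_conv_m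
           (\<lambda>n. distr (measure_pmf (uniform_permutation n)) borel
              (\<lambda>\<pi>. real (min_degree (with_proj (permutation_graph n \<pi>))) / sqrt (real n)))
           (rayleigh_distribution (1 / sqrt 2)) \<and>
         (\<forall>\<gamma>>0. measure (rayleigh_distribution (1 / sqrt 2)) {\<gamma><..} = exp (- \<gamma>\<^sup>2))"
proof (intro conjI allI impI)
  fix \<gamma> :: real assume "\<gamma> > 0"
  then show "measure (rayleigh_distribution (1 / sqrt 2)) {\<gamma><..} = exp (- \<gamma>\<^sup>2)"
    by (intro measure_rayleigh_greaterThan) simp
next
  let ?d = "\<lambda>n \<pi>. real (min_degree (with_proj (permutation_graph n \<pi>)))"
  let ?D = "\<lambda>n. distr (measure_pmf (uniform_permutation n)) borel (\<lambda>\<pi>. ?d n \<pi> / sqrt (real n))"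
  have cdf: "cdf (?D n) x = prob_perm n (\<lambda>\<pi>. ?d n \<pi> / sqrt (real n) \<le> x)" for n x
    unfolding cdf_def by (subst measure_distr) (auto simp: vimage_def)
  have "(\<lambda>n. cdf (?D n) x) \<longlonglongrightarrow> cdf (rayleigh_distribution (1 / sqrt 2)) x" for x
  proof (cases "x < 0")
    \<comment> \<open>Below zero, both distribution functions vanish.\<close>
    case True
    have "\<not> ?d n \<pi> / sqrt (real n) \<le> x" for n \<pi>
    proof -
      have "0 \<le> ?d n \<pi> / sqrt (real n)" by simp
      with True show ?thesis by linarith
    qed
    then show ?thesis
      unfolding cdf cdf_rayleigh using True by simp
  next
    case False
    then have "(\<lambda>n. 1 - prob_perm n (\<lambda>\<pi>. x * sqrt n < ?d n \<pi>)) \<longlonglongrightarrow> 1 - exp (- x\<^sup>2)"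
      by (intro tendsto_intros prob_min_degree_limit) simp
    moreover have "\<forall>\<^sub>F n in sequentially. 1 - prob_perm n (\<lambda>\<pi>. x * sqrt n < ?d n \<pi>) = cdf (?D n) x"
      using eventually_gt_at_top[of 0]
    proof eventually_elim
      case (elim n)
      have "{\<pi>. ?d n \<pi> / sqrt (real n) \<le> x} = space (measure_pmf (uniform_permutation n)) - {\<pi>. x * sqrt n < ?d n \<pi>}"
        using elim by (auto simp: field_simps)
      then show ?case
        unfolding cdf by (simp only:) (rule measure_pmf.prob_compl[symmetric], simp)
    qed
    ultimately show ?thesis
      unfolding cdf_rayleigh using False by (simp add: Lim_transform_eventually)
  qed
  then show "weak_conv_m ?D (rayleigh_distribution (1 / sqrt 2))"
    by (simp add: weak_conv_m_def weak_conv_def)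
qed

end
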